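(* Let $(n_j,k_j)_{j\geqslant 1}$ be a sequence of pairs of integers with $n_j\geqslant k_j\geqslant 3$ for all $j$, $n_j\to\infty$ and $k_j/n_j\to 0$ as $j\to\infty$. For each $j$ let $c_j,r_j$ be the integers with $n_j=c_jk_j+r_j$ and $r_j\in\{0,\ldots,k_j-1\}$. Suppose that either (a) for every $j$, $n_j$ is even and $r_j\notin\{1,k_j-1\}$; or (b) $k_j-r_j\to\infty$ as $j\to\infty$. Then ${\rm SP}(n_j,k_j)/{\rm MMS}(n_j,k_j)\to 1$ as $j\to\infty$.
   Context: For integers $n\geqslant k\geqslant 1$, an $(n,k)$-Sperner partition system is a collection of partitions of some $n$-element set, each into exactly $k$ nonempty classes, such that no class of any partition in the collection is a subset of a class of any other partition in the collection. ${\rm SP}(n,k)$ denotes the maximum number of partitions in an $(n,k)$-Sperner partition system. For $n\geqslant k$, $c$ and $r$ denote the unique integers with $n=ck+r$ and $r\in\{0,\ldots,k-1\}$, and ${\rm MMS}(n,k)=\binom{n}{c}\big/\big(k-r+\frac{r(c+1)}{n-c}\big)$. *)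

theory Defs
  imports Complex_Main "HOL-Library.Disjoint_Sets"
begin

definition sperner_partition_system :: "nat \<Rightarrow> nat \<Rightarrow> 'a set set set \<Rightarrow> bool" where
  "sperner_partition_system n k C \<longleftrightarrow>
     (\<exists>X. finite X \<and> card X = n \<and>
        (\<forall>P\<in>C. partition_on X P \<and> card P = k) \<and>
        (\<forall>P\<in>C. \<forall>Q\<in>C. P \<noteq> Q \<longrightarrow> (\<forall>A\<in>P. \<forall>B\<in>Q. \<not> A \<subseteq> B)))"

text \<open>The ground set is taken among the sets of natural numbers; \<open>SP_upper\<close> and \<open>SP_attained\<close>
  below show that the maximum exists and bounds the systems over every type.\<close>

definition SP :: "nat \<Rightarrow> nat \<Rightarrow> nat" where
  "SP n k = Max {card C |C :: nat set set set. sperner_partition_system n k C}"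

text \<open>For \<open>k = 1\<close> we have \<open>n = c\<close> and \<open>r = 0\<close>, and the inner fraction is \<open>0 / 0 = 0\<close>.\<close>

definition MMS :: "nat \<Rightarrow> nat \<Rightarrow> real" where
  "MMS n k = (let c = n div k; r = n mod k in
     real (n choose c) / (real k - real r + real r * (real c + 1) / (real n - real c)))"

lemma sperner_partition_system_card_le:
  assumes "sperner_partition_system n k C"
  shows "card C \<le> 2 ^ 2 ^ n"
proof -
  obtain X where X: "finite X" "card X = n" and "\<forall>P\<in>C. partition_on X P \<and> card P = k"
    using assms unfolding sperner_partition_system_def by (elim exE conjE)
  then have "P \<subseteq> Pow X" if "P \<in> C" for P
    using that by (auto dest: partition_onD1)
  then have "C \<subseteq> Pow (Pow X)"
    by blast
  then have "card C \<le> card (Pow (Pow X))"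
    by (intro card_mono) (simp_all add: X)
  also have "\<dots> = 2 ^ 2 ^ n"
    by (simp only: card_Pow finite_Pow_iff X)
  finally show ?thesis .
qed

lemma finite_sperner_cards:
  "finite {card C |C :: 'a set set set. sperner_partition_system n k C}"
proof (rule finite_subset)
  show "{card C |C :: 'a set set set. sperner_partition_system n k C} \<subseteq> {..2 ^ 2 ^ n}"
    using sperner_partition_system_card_le by blast
qed (rule finite_atMost)

lemma SP_attained: "\<exists>C :: nat set set set. sperner_partition_system n k C \<and> card C = SP n k"
proof -
  have "sperner_partition_system n k ({} :: nat set set set)"
    unfolding sperner_partition_system_def by (intro exI[of _ "{..<n}"]) simp
  then have "{card C |C :: nat set set set. sperner_partition_system n k C} \<noteq> {}"
    by blast
  then have "SP n k \<in> {card C |C :: nat set set set. sperner_partition_system n k C}"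
    unfolding SP_def by (rule Max_in[OF finite_sperner_cards])
  then obtain C :: "nat set set set" where "SP n k = card C" "sperner_partition_system n k C"
    unfolding mem_Collect_eq by (elim exE conjE)
  then show ?thesis
    by (intro exI[of _ C]) simp
qed

lemma SP_upper:
  fixes C :: "'a set set set"
  assumes "sperner_partition_system n k C"
  shows "card C \<le> SP n k"
proof -
  obtain X where "finite X \<and> card X = n \<and>
      (\<forall>P\<in>C. partition_on X P \<and> card P = k) \<and>
      (\<forall>P\<in>C. \<forall>Q\<in>C. P \<noteq> Q \<longrightarrow> (\<forall>A\<in>P. \<forall>B\<in>Q. \<not> A \<subseteq> B))"
    using assms unfolding sperner_partition_system_def ..
  then have X: "finite X" "card X = n"
    and P: "\<And>P. P \<in> C \<Longrightarrow> partition_on X P" "\<And>P. P \<in> C \<Longrightarrow> card P = k"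
    and S: "\<And>P Q A B. P \<in> C \<Longrightarrow> Q \<in> C \<Longrightarrow> P \<noteq> Q \<Longrightarrow> A \<in> P \<Longrightarrow> B \<in> Q \<Longrightarrow> \<not> A \<subseteq> B"
    by simp_all
  obtain f :: "'a \<Rightarrow> nat" where f: "bij_betw f X {..<n}"
    using ex_bij_betw_finite_nat[OF X(1)] X(2) by (auto simp: atLeast0LessThan)
  then have inj: "inj_on f X" and im: "f ` X = {..<n}"
    by (auto simp: bij_betw_def)
  define g where "g = (\<lambda>P. (`) f ` P)"
  have sub: "P \<subseteq> Pow X" if "P \<in> C" for P
    using P(1)[OF that] unfolding partition_on_def by blast
  have injI: "inj_on ((`) f) (Pow X)"
    using inj by (rule inj_on_image_Pow)
  have injg: "inj_on g C"
    unfolding g_def by (rule inj_on_subset[OF inj_on_image_Pow[OF injI]]) (use sub in blast)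
  have "partition_on {..<n} (g P) \<and> card (g P) = k" if "P \<in> C" for P
  proof
    show "card (g P) = k"
      unfolding g_def using P(2)[OF that] inj_on_subset[OF injI sub[OF that]] by (simp add: card_image)
    show "partition_on {..<n} (g P)"
    proof (rule partition_onI)
      show "\<Union> (g P) = {..<n}"
        using partition_onD1[OF P(1)[OF that]] im unfolding g_def by blast
    next
      fix p q assume "p \<in> g P" "q \<in> g P" "p \<noteq> q"
      then obtain A B where AB: "p = f ` A" "q = f ` B" "A \<in> P" "B \<in> P" "A \<noteq> B"
        unfolding g_def by blast
      then have "A \<inter> B = {}"
        using partition_onD2[OF P(1)[OF that]] by (auto dest: disjointD)
      moreover have "A \<subseteq> X" "B \<subseteq> X"
        using AB sub[OF that] by auto
      ultimately show "disjnt p q"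
        using AB inj by (metis disjnt_def image_empty inj_on_image_Int)
    next
      show "{} \<notin> g P"
        using partition_onD3[OF P(1)[OF that]] unfolding g_def by auto
    qed
  qed
  moreover have "\<not> p \<subseteq> q" if h: "P \<in> C" "Q \<in> C" "g P \<noteq> g Q" "p \<in> g P" "q \<in> g Q" for P Q p q
  proof -
    obtain A B where AB: "p = f ` A" "q = f ` B" "A \<in> P" "B \<in> Q"
      using h unfolding g_def by blast
    moreover have "A \<subseteq> X" "B \<subseteq> X"
      using AB h sub by blast+
    moreover have "\<not> A \<subseteq> B"
      using S h AB by blast
    ultimately show ?thesis
      using inj unfolding inj_on_def by blast
  qed
  ultimately have "sperner_partition_system n k (g ` C)"
    unfolding sperner_partition_system_def
    by (intro exI[of _ "{..<n}"]) simp
  then have "card (g ` C) \<le> SP n k"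
    unfolding SP_def by (intro Max_ge finite_sperner_cards) blast
  then show ?thesis
    using injg by (simp add: card_image)
qed

end

theory Submission
  imports Defs "HOL-Combinatorics.Transposition"
begin

text \<open>
  The upper bound \<open>SP n k \<le> MMS n k\<close> is the LYM inequality together with the convexity of
  \<open>s \<mapsto> 1 / (n choose s)\<close>.

  For the lower bound with \<open>n = 2 * h\<close> even, split the ground set into two halves and call the size of the
  intersection of a set with the first half its type. By Bryant's theorem, a list of \<open>k - r\<close> types of
  \<open>c\<close>-sets and \<open>r\<close> types of \<open>(c + 1)\<close>-sets with sum \<open>h\<close> for each of \<open>p\<close> partitions can be realised by genuine
  partitions as soon as no type is used more often than there are sets of that type. One of the two
  sizes uses the types near the middle and the other the remaining extreme types, which makes the
  system Sperner and wastes only boundary types; these are a vanishing proportion as \<open>c\<close> grows. Complementary types are paired to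
  get the right sum, and an odd number of classes of one size is handled by one triple, which
  is possible unless that number is \<open>1\<close>: this is where \<open>r \<noteq> 1\<close> and \<open>r \<noteq> k - 1\<close> are needed.

  When \<open>k - r\<close> tends to infinity, \<open>MMS\<close> changes by a factor tending to \<open>1\<close> when at most two points are
  removed. As \<open>SP n k \<le> SP (n + 1) k\<close>, this reduces the other cases to even \<open>n\<close> or to \<open>r = 0\<close>, where a single
  part suffices.
\<close>

subsection \<open>The upper bound and monotonicity\<close>

text \<open>Recolouring needs a family closed under the transpositions inside each part. With one
  part such a family is a union of levels, and levels \<open>c\<close> and \<open>c + 1\<close>
  together are not an antichain; so one part serves only \<open>r = 0\<close>. Two parts let both
  sizes coexist, because a \<open>c\<close>-set of type \<open>i\<close> lies only in
  \<open>(c + 1)\<close>-sets of types \<open>i\<close> and \<open>i + 1\<close>. The price is the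
  sum condition on types, met separately for each size by an average type of half the size. A size
  with a single class would have to use its middle type in every partition, and one type carries a
  vanishing proportion of the sets: hence the exclusion of \<open>r = 1\<close> and
  \<open>r = k - 1\<close>. Little is lost, because extreme types fill nearly the same proportion of
  both levels, and the ratio of the level sizes is exactly the factor
  \<open>(c + 1) / (n - c)\<close> in \<open>MMS\<close>. For even \<open>n\<close> the error
  depends on \<open>c\<close> alone, and \<open>k / n\<close> tending to \<open>0\<close> sends
  \<open>c\<close> to infinity.\<close>

lemma Suc_mult_choose_Suc: "Suc i * (n choose Suc i) = (n - i) * (n choose i)"
  using binomial_absorption[of i n] binomial_absorb_comp[of n i] by (cases n) auto

text \<open>Induction on \<open>card V\<close>: apply the inequality to the sets avoiding a point \<open>x\<close> inside
  \<open>V - {x}\<close>, and sum over \<open>x\<close>.\<close>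

lemma LYM_inequality:
  assumes "finite V" "F \<subseteq> Pow V" "\<And>A B. A \<in> F \<Longrightarrow> B \<in> F \<Longrightarrow> A \<subseteq> B \<Longrightarrow> A = B"
  shows "(\<Sum>A\<in>F. 1 / real (card V choose card A)) \<le> 1"
  using assms
proof (induction "card V" arbitrary: V F)
  case 0
  then have "F \<subseteq> {{}}" by auto
  then consider "F = {}" | "F = {{}}" by blast
  then show ?case using 0 by cases auto
next
  case (Suc n)
  have fin: "finite F" "\<And>A. A \<in> F \<Longrightarrow> finite A"
    using Suc.prems by (meson finite_Pow_iff finite_subset Pow_iff subsetD)+
  show ?case
  proof (cases "V \<in> F")
    case True
    then have "F = {V}"
      using Suc.prems by blast
    then show ?thesis by simp
  next
    case False
    have eq: "real (card V) / real (card V choose card A) = (\<Sum>x\<in>V - A. 1 / real (n choose card A))"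
      if "A \<in> F" for A
    proof -
      have "A \<subset> V" using that False Suc.prems(2) by blast
      then have less: "card A < card V" using Suc.prems(1) by (rule psubset_card_mono[rotated])
      have "(Suc n - card A) * (Suc n choose card A) = Suc n * (n choose card A)"
        using binomial_absorb_comp[of "Suc n" "card A"] by simp
      then have "real (Suc n - card A) * real (Suc n choose card A) = real (Suc n) * real (n choose card A)"
        by (metis of_nat_mult)
      moreover have "card (V - A) = Suc n - card A"
        using \<open>A \<subset> V\<close> Suc.hyps(2) fin(2)[OF that] by (simp add: card_Diff_subset psubset_imp_subset)
      moreover have "(Suc n choose card A) > 0" "(n choose card A) > 0"
        using less Suc.hyps(2) by (simp_all)
      ultimately show ?thesis
        using Suc.hyps(2)[symmetric] by (simp add: divide_simps mult.commute del: of_nat_Suc binomial_Suc_Suc)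
    qed
    have "real (card V) * (\<Sum>A\<in>F. 1 / real (card V choose card A))
        = (\<Sum>A\<in>F. \<Sum>x\<in>V. if x \<notin> A then 1 / real (n choose card A) else 0)"
      unfolding sum_distrib_left
    proof (rule sum.cong)
      fix A assume A: "A \<in> F"
      have "V - A = {x \<in> V. x \<notin> A}" by blast
      then show "real (card V) * (1 / real (card V choose card A))
          = (\<Sum>x\<in>V. if x \<notin> A then 1 / real (n choose card A) else 0)"
        using eq[OF A] sum.inter_filter[OF Suc.prems(1), of "\<lambda>_. 1 / real (n choose card A)" "\<lambda>x. x \<notin> A"]
        by simp
    qed simp
    also have "\<dots> = (\<Sum>x\<in>V. \<Sum>A | A \<in> F \<and> x \<notin> A. 1 / real (n choose card A))"
      using fin(1) by (subst sum.swap) (simp only: sum.inter_filter)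
    also have "\<dots> \<le> (\<Sum>x\<in>V. 1)"
    proof (rule sum_mono)
      fix x assume "x \<in> V"
      then have n: "n = card (V - {x})"
        using Suc by simp
      show "(\<Sum>A | A \<in> F \<and> x \<notin> A. 1 / real (n choose card A)) \<le> 1"
        using Suc.hyps(1)[OF n, of "{A \<in> F. x \<notin> A}"] Suc.prems unfolding n by blast
    qed
    finally have "real (card V) * (\<Sum>A\<in>F. 1 / real (card V choose card A)) \<le> real (card V) * 1"
      by simp
    moreover have "real (card V) > 0" using Suc.hyps(2) by linarith
    ultimately show ?thesis
      by (simp only: mult_le_cancel_left_pos)
  qed
qed

text \<open>Divided by the middle binomial's inverse, the outer terms become the ratios
  \<open>(b + 1) / a\<close> and \<open>(a + 1) / b\<close> of neighbouring binomials, and the claim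
  follows from \<open>2 * a * b \<le> a^2 + b^2\<close>.\<close>

lemma inverse_binomial_convex:
  assumes "s + 2 \<le> n"
  shows "2 / real (n choose (s + 1)) \<le> 1 / real (n choose s) + 1 / real (n choose (s + 2))"
proof -
  define C where "C = real (n choose (s + 1))"
  define a where "a = real s + 1"
  define b where "b = real n - real s - 1"
  have ab: "a > 0" "b > 0" "C > 0" using assms by (auto simp: a_def b_def C_def)
  have "(n - s) * (n choose s) = (s + 1) * (n choose (s + 1))"
    using Suc_mult_choose_Suc[of s n] by simp
  then have "real (n - s) * real (n choose s) = real (s + 1) * real (n choose (s + 1))"
    by (metis of_nat_mult)
  then have 1: "(b + 1) * real (n choose s) = a * C"
    using assms unfolding a_def b_def C_def
    by (simp add: of_nat_diff)
  have "(n - (s + 1)) * (n choose (s + 1)) = (s + 2) * (n choose (s + 2))"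
    using Suc_mult_choose_Suc[of "s + 1" n] by simp
  then have "real (n - (s + 1)) * C = real (s + 2) * real (n choose (s + 2))"
    unfolding C_def by (metis of_nat_mult)
  then have 2: "b * C = (a + 1) * real (n choose (s + 2))"
    using assms unfolding a_def b_def by (simp add: of_nat_diff algebra_simps)
  have e1: "1 / real (n choose s) = (b + 1) / (a * C)"
    using 1 ab assms by (simp add: divide_simps)
  have e2: "1 / real (n choose (s + 2)) = (a + 1) / (b * C)"
    using 2 ab assms by (simp add: divide_simps)
  have "2 * (a * b) \<le> (b + 1) * b + (a + 1) * a"
    using ab sum_squares_ge_zero[of "a - b" 0] by (simp add: algebra_simps)
  then have "2 \<le> (b + 1) / a + (a + 1) / b"
    using ab by (simp add: divide_simps algebra_simps)
  then have "2 / C \<le> ((b + 1) / a + (a + 1) / b) / C"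
    using ab by (intro divide_right_mono) auto
  then have "2 / C \<le> (b + 1) / (a * C) + (a + 1) / (b * C)"
    by (simp only: add_divide_distrib divide_divide_eq_left)
  then show ?thesis
    unfolding e1 e2 C_def .
qed

text \<open>For a discretely convex function the line through the consecutive points
  \<open>c\<close> and \<open>c + 1\<close> lies below the function at every integer.\<close>

lemma inverse_binomial_supporting_line:
  assumes c: "c + 1 \<le> n" and s: "s \<le> n"
  defines "g \<equiv> \<lambda>s. 1 / real (n choose s)"
  shows "g s \<ge> g c + (real s - real c) * (g (c + 1) - g c)"
proof -
  have conv: "g (i + 1) - g i \<le> g (i + 2) - g (i + 1)" if "i + 2 \<le> n" for i
    using inverse_binomial_convex[OF that] by (simp add: g_def)
  have mono: "g (i + 1) - g i \<le> g (j + 1) - g j" if "i \<le> j" "j + 1 \<le> n" for i j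
    using that
  proof (induction j rule: dec_induct)
    case (step j)
    then show ?case using assms conv[of j] by simp
  qed simp
  show ?thesis
  proof (cases "c \<le> s")
    case True
    then show ?thesis using s
    proof (induction s rule: dec_induct)
      case (step s)
      then show ?case using mono[of c s] by (simp add: algebra_simps)
    qed simp
  next
    case False
    then have "s \<le> c" by simp
    then show ?thesis
    proof (induction s rule: inc_induct)
      case (step s)
      then show ?case using mono[of s c] c by (simp add: algebra_simps)
    qed simp
  qed
qed

text \<open>Summed over the classes, the supporting line sees only their number \<open>k\<close> and
  total size \<open>n\<close>; so the bound is the value for \<open>k - r\<close> classes of size
  \<open>c\<close> and \<open>r\<close> of size \<open>c + 1\<close>.\<close>

lemma sum_inverse_binomial_ge:
  assumes n: "n = c * k + r" "c + 1 \<le> n"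
    and P: "finite P" "card P = k" "(\<Sum>A\<in>P. card A) = n" "\<And>A. A \<in> P \<Longrightarrow> card A \<le> n"
  shows "(real k - real r + real r * (real c + 1) / (real n - real c)) / real (n choose c)
    \<le> (\<Sum>A\<in>P. 1 / real (n choose card A))"
proof -
  define g where "g s = 1 / real (n choose s)" for s
  have "(n - c) * (n choose c) = (c + 1) * (n choose (c + 1))"
    using Suc_mult_choose_Suc[of c n] by simp
  then have "real (n - c) * real (n choose c) = real (c + 1) * real (n choose (c + 1))"
    by (metis of_nat_mult)
  then have g: "g (c + 1) = (real c + 1) / (real n - real c) / real (n choose c)"
    using n(2) by (simp add: g_def of_nat_diff divide_simps)
  have "real (\<Sum>A\<in>P. card A) = real c * real k + real r"
    using P(3) n(1) by simp
  then have tot: "(\<Sum>A\<in>P. real (card A) - real c) = real r"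
    by (simp add: sum_subtractf P(2))
  have "(real k - real r) * g c + real r * g (c + 1)
      = (\<Sum>A\<in>P. g c) + (\<Sum>A\<in>P. real (card A) - real c) * (g (c + 1) - g c)"
    by (simp add: tot P(2) algebra_simps)
  also have "\<dots> = (\<Sum>A\<in>P. g c + (real (card A) - real c) * (g (c + 1) - g c))"
    by (simp add: sum.distrib sum_distrib_right)
  also have "\<dots> \<le> (\<Sum>A\<in>P. g (card A))"
    unfolding g_def using inverse_binomial_supporting_line[OF n(2)] P(4) by (intro sum_mono) auto
  finally show ?thesis
    unfolding g by (simp add: g_def add_divide_distrib distrib_left)
qed

lemma sperner_partition_system_card_le_MMS:
  assumes "sperner_partition_system n k C" "n = c * k + r" "r < k" "c + 1 \<le> n"
  shows "real (card C) * (real k - real r + real r * (real c + 1) / (real n - real c)) \<le> real (n choose c)"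
proof -
  obtain X where "finite X \<and> card X = n \<and>
      (\<forall>P\<in>C. partition_on X P \<and> card P = k) \<and>
      (\<forall>P\<in>C. \<forall>Q\<in>C. P \<noteq> Q \<longrightarrow> (\<forall>A\<in>P. \<forall>B\<in>Q. \<not> A \<subseteq> B))"
    using assms(1) unfolding sperner_partition_system_def ..
  then have X: "finite X" "card X = n"
    and P: "\<And>P. P \<in> C \<Longrightarrow> partition_on X P" "\<And>P. P \<in> C \<Longrightarrow> card P = k"
    and S: "\<And>P Q A B. P \<in> C \<Longrightarrow> Q \<in> C \<Longrightarrow> P \<noteq> Q \<Longrightarrow> A \<in> P \<Longrightarrow> B \<in> Q \<Longrightarrow> \<not> A \<subseteq> B"
    by simp_all
  have sub: "\<Union> C \<subseteq> Pow X"
    using P(1) unfolding partition_on_def by blast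
  have fin: "finite C" "\<And>P. P \<in> C \<Longrightarrow> finite P"
    using sub X(1) P(1) finite_elements
    by (meson finite_Pow_iff finite_subset Sup_upper finite_UnionD)+
  define D where "D = real k - real r + real r * (real c + 1) / (real n - real c)"
  have "real (card C) * (D / real (n choose c)) = (\<Sum>P\<in>C. D / real (n choose c))"
    by simp
  also have "\<dots> \<le> (\<Sum>P\<in>C. \<Sum>A\<in>P. 1 / real (n choose card A))"
  proof (rule sum_mono)
    fix Q assume Q: "Q \<in> C"
    have "(\<Sum>A\<in>Q. card A) = card X"
      using P(1)[OF Q] X(1) by (metis partition_onD1 partition_onD2 card_Union_disjoint disjoint_def
        disjnt_def pairwise_def finite_subset Sup_upper)
    moreover have "card A \<le> n" if "A \<in> Q" for A
      using that Q sub X by (metis Pow_iff UnionI card_mono subsetD)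
    ultimately show "D / real (n choose c) \<le> (\<Sum>A\<in>Q. 1 / real (n choose card A))"
      unfolding D_def using sum_inverse_binomial_ge[OF assms(2,4) fin(2)[OF Q] P(2)[OF Q]] X(2) by simp
  qed
  also have "\<dots> = (\<Sum>A\<in>\<Union>C. 1 / real (n choose card A))"
  proof (rule sum.Union_disjoint[symmetric, unfolded comp_def])
    show "\<forall>A\<in>C. \<forall>B\<in>C. A \<noteq> B \<longrightarrow> A \<inter> B = {}"
      using S by blast
  qed (use fin in auto)
  also have "\<dots> \<le> 1"
    unfolding X(2)[symmetric]
  proof (rule LYM_inequality[OF X(1) sub])
    fix A B assume "A \<in> \<Union>C" "B \<in> \<Union>C" "A \<subseteq> B"
    \<comment> \<open>Comparable classes come from the same partition, where distinct classes are
      disjoint and nonempty.\<close>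
    then obtain Q where Q: "Q \<in> C" "A \<in> Q" "B \<in> Q" using S by blast
    then have "A \<noteq> {}" "A \<noteq> B \<Longrightarrow> A \<inter> B = {}"
      using P(1) by (auto dest: partition_onD2 partition_onD3 disjointD)
    then show "A = B" using \<open>A \<subseteq> B\<close> by blast
  qed
  finally show ?thesis
    using assms(4) by (simp add: D_def[symmetric] pos_divide_le_eq)
qed

text \<open>Put the new point into one class of each partition. Deleting it turns every new class
  back into an old one, so an inclusion across two partitions would already have existed.\<close>

lemma SP_add_point:
  assumes "k > 0"
  shows "SP n k \<le> SP (Suc n) k"
proof -
  obtain C :: "nat set set set" where C: "sperner_partition_system n k C" "card C = SP n k"
    using SP_attained by blast
  obtain X where "finite X \<and> card X = n \<and>
      (\<forall>P\<in>C. partition_on X P \<and> card P = k) \<and>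
      (\<forall>P\<in>C. \<forall>Q\<in>C. P \<noteq> Q \<longrightarrow> (\<forall>A\<in>P. \<forall>B\<in>Q. \<not> A \<subseteq> B))"
    using C(1) unfolding sperner_partition_system_def ..
  then have X: "finite X" "card X = n"
    and P: "\<And>P. P \<in> C \<Longrightarrow> partition_on X P" "\<And>P. P \<in> C \<Longrightarrow> card P = k"
    and S: "\<And>P Q A B. P \<in> C \<Longrightarrow> Q \<in> C \<Longrightarrow> P \<noteq> Q \<Longrightarrow> A \<in> P \<Longrightarrow> B \<in> Q \<Longrightarrow> \<not> A \<subseteq> B"
    by simp_all
  obtain x where x: "x \<notin> X"
    using X(1) ex_new_if_finite[of X] infinite_UNIV_nat by auto
  have "\<exists>E. E \<in> P" if "P \<in> C" for P
    using P(2)[OF that] assms by (metis card.empty ex_in_conv less_irrefl)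
  then obtain e where e: "\<And>P. P \<in> C \<Longrightarrow> e P \<in> P"
    by metis
  define g where "g P = insert (insert x (e P)) (P - {e P})" for P
  have x': "x \<notin> A" if "P \<in> C" "A \<in> P" for A P
    using P(1)[OF that(1)] that(2) x by (auto dest: partition_onD1)
  have removed: "A - {x} \<in> P" if "P \<in> C" "A \<in> g P" for A P
    using that e[OF that(1)] x'[OF that(1)] by (auto simp: g_def)
  have "partition_on (insert x X) (g P) \<and> card (g P) = k" if "P \<in> C" for P
  proof
    note p = P(1)[OF that]
    show "card (g P) = k"
      using e[OF that] x'[OF that] P(2)[OF that] assms card_ge_0_finite[of P]
      by (auto simp: g_def card_insert_if)
    show "partition_on (insert x X) (g P)"
    proof (rule partition_onI)
      show "\<Union> (g P) = insert x X"
        using partition_onD1[OF p] e[OF that] by (auto simp: g_def)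
      show "{} \<notin> g P"
        using partition_onD3[OF p] by (auto simp: g_def)
    next
      fix A B assume AB: "A \<in> g P" "B \<in> g P" "A \<noteq> B"
      have disj: "A \<inter> B = {}" if "A \<in> P" "B \<in> P" "A \<noteq> B" for A B
        using partition_onD2[OF p] that by (auto dest: disjointD)
      show "disjnt A B"
        using AB e[OF that] x'[OF that] disj[of A B] disj[of "e P" B] disj[of A "e P"]
        by (auto simp: g_def disjnt_def)
    qed
  qed
  moreover have sp: "\<not> A \<subseteq> B" if "P \<in> C" "Q \<in> C" "P \<noteq> Q" "A \<in> g P" "B \<in> g Q" for P Q A B
    using S[OF that(1-3) removed[OF that(1,4)] removed[OF that(2,5)]] by blast
  ultimately have "sperner_partition_system (Suc n) k (g ` C)"
    unfolding sperner_partition_system_def using X x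
    by (intro exI[of _ "insert x X"]) (simp, metis)
  then have "card (g ` C) \<le> SP (Suc n) k"
    by (rule SP_upper)
  moreover have "inj_on g C"
  proof (rule inj_onI, rule ccontr)
    fix P Q assume "P \<in> C" "Q \<in> C" "g P = g Q" "P \<noteq> Q"
    then show False
      using sp[of P Q "insert x (e P)" "insert x (e P)"] by (auto simp: g_def)
  qed
  ultimately show ?thesis
    using C(2) by (simp add: card_image)
qed

subsection \<open>Almost regular recolourings\<close>

text \<open>Each \<open>i\<close> is an arc from \<open>f i\<close> to \<open>g i\<close> of a multigraph, and \<open>\<sigma> i = -1\<close> reverses it; the sum is the
  out-degree minus the in-degree of \<open>q\<close>. Induction on the number of arcs: drop a loop, or replace two
  arcs at a common vertex by one arc between their other ends.\<close>

lemma balanced_orientation: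
  fixes f g :: "'i \<Rightarrow> 'c"
  assumes "finite I"
  shows "\<exists>\<sigma> :: 'i \<Rightarrow> int. (\<forall>i. \<sigma> i = 1 \<or> \<sigma> i = -1) \<and>
    (\<forall>q. \<bar>\<Sum>i\<in>I. \<sigma> i * (of_bool (f i = q) - of_bool (g i = q))\<bar> \<le> 1)"
  using assms
proof (induction "card I" arbitrary: I f g rule: less_induct)
  case less
  let ?e = "\<lambda>f g i q. of_bool (f i = q) - of_bool (g i = q) :: int"
  \<comment> \<open>The sign \<open>s\<close> orients the second arc so that the common vertex
    cancels: it is \<open>-1\<close> if both arcs start or both end there.\<close>
  consider (loop) i where "i \<in> I" "f i = g i"
    | (path) i j a b s where "i \<in> I" "j \<in> I" "i \<noteq> j" "s = 1 \<or> s = -1"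
      "\<And>q. ?e f g i q + s * ?e f g j q = of_bool (a = q) - of_bool (b = q)"
    | (matching) "\<And>i. i \<in> I \<Longrightarrow> f i \<noteq> g i"
      "\<And>i j. i \<in> I \<Longrightarrow> j \<in> I \<Longrightarrow> i \<noteq> j \<Longrightarrow> {f i, g i} \<inter> {f j, g j} = {}"
  proof -
    have "thesis" if ij: "i \<in> I" "j \<in> I" "i \<noteq> j" "{f i, g i} \<inter> {f j, g j} \<noteq> {}" for i j
    proof -
      consider "g i = f j" | "f i = f j" | "g i = g j" | "f i = g j"
        using ij(4) by blast
      then show thesis
      proof cases
        case 1
        then show ?thesis by (intro path[of i j 1 "f i" "g j"] ij) auto
      next
        case 2
        then show ?thesis by (intro path[of i j "-1" "g j" "g i"] ij) auto
      next
        case 3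
        then show ?thesis by (intro path[of i j "-1" "f i" "f j"] ij) auto
      next
        case 4
        then show ?thesis by (intro path[of i j 1 "f j" "g i"] ij) auto
      qed
    qed
    then show thesis
      using loop matching by metis
  qed
  then show ?case
  proof cases
    case loop
    then have "card (I - {i}) < card I"
      using less.prems by (meson card_Diff1_less)
    then obtain \<sigma> :: "'i \<Rightarrow> int" where "\<forall>i. \<sigma> i = 1 \<or> \<sigma> i = -1"
      "\<forall>q. \<bar>\<Sum>i\<in>I - {i}. \<sigma> i * ?e f g i q\<bar> \<le> 1"
      using less.hyps[of "I - {i}" f g] less.prems by auto
    moreover have "(\<Sum>i\<in>I. \<sigma> i * ?e f g i q) = (\<Sum>i\<in>I - {i}. \<sigma> i * ?e f g i q)" for q
      using loop less.prems by (subst sum.remove[of I i]) auto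
    ultimately show ?thesis
      by (intro exI[of _ \<sigma>]) simp
  next
    case path
    define f' g' where "f' = f(i := a)" and "g' = g(i := b)"
    have "card (I - {j}) < card I"
      using less.prems path by (meson card_Diff1_less)
    then obtain \<sigma> :: "'i \<Rightarrow> int" where \<sigma>: "\<And>i. \<sigma> i = 1 \<or> \<sigma> i = -1"
      "\<And>q. \<bar>\<Sum>i\<in>I - {j}. \<sigma> i * ?e f' g' i q\<bar> \<le> 1"
      using less.hyps[of "I - {j}" f' g'] less.prems by auto
    define \<sigma>' where "\<sigma>' = \<sigma>(j := \<sigma> i * s)"
    have "(\<Sum>x\<in>I. \<sigma>' x * ?e f g x q) = (\<Sum>x\<in>I - {j}. \<sigma> x * ?e f' g' x q)" for q
    proof -
      have "(\<Sum>x\<in>I. \<sigma>' x * ?e f g x q)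
          = \<sigma>' j * ?e f g j q + (\<sigma>' i * ?e f g i q + (\<Sum>x\<in>I - {j} - {i}. \<sigma>' x * ?e f g x q))"
        using path less.prems by (subst sum.remove[of I j], simp, simp, subst sum.remove[of "I - {j}" i]) auto
      also have "(\<Sum>x\<in>I - {j} - {i}. \<sigma>' x * ?e f g x q) = (\<Sum>x\<in>I - {j} - {i}. \<sigma> x * ?e f' g' x q)"
        by (rule sum.cong) (auto simp: \<sigma>'_def f'_def g'_def)
      also have "\<sigma>' j * ?e f g j q + (\<sigma>' i * ?e f g i q + \<dots>)
          = \<sigma> i * (?e f g i q + s * ?e f g j q) + \<dots>"
        using path(3) by (simp add: \<sigma>'_def algebra_simps)
      also have "\<dots> = \<sigma> i * ?e f' g' i q + (\<Sum>x\<in>I - {j} - {i}. \<sigma> x * ?e f' g' x q)"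
        by (simp only: path(5)) (simp add: f'_def g'_def)
      also have "\<dots> = (\<Sum>x\<in>I - {j}. \<sigma> x * ?e f' g' x q)"
        using path less.prems by (subst sum.remove[of "I - {j}" i]) auto
      finally show ?thesis .
    qed
    moreover have "\<forall>x. \<sigma>' x = 1 \<or> \<sigma>' x = -1"
    proof
      fix x
      show "\<sigma>' x = 1 \<or> \<sigma>' x = -1"
        using \<sigma>(1)[of i] \<sigma>(1)[of x] path(4) by (cases "x = j"; auto simp: \<sigma>'_def)
    qed
    ultimately show ?thesis
      using \<sigma>(2) by (intro exI[of _ \<sigma>']) simp
  next
    case matching
    \<comment> \<open>In a matching every vertex meets at most one arc, so any orientation
      works.\<close>
    have "\<bar>\<Sum>i\<in>I. 1 * ?e f g i q\<bar> \<le> 1" for q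
    proof (cases "\<exists>i\<in>I. ?e f g i q \<noteq> 0")
      case True
      then obtain i where i: "i \<in> I" "?e f g i q \<noteq> 0"
        by blast
      then have i': "f i = q \<or> g i = q"
        by (cases "f i = q") auto
      have "?e f g x q = 0" if "x \<in> I - {i}" for x
        using matching(2)[of i x] i(1) i' that by auto
      then have "(\<Sum>x\<in>I. ?e f g x q) = ?e f g i q"
        using i(1) less.prems by (simp add: sum.remove[of I i])
      then show ?thesis by simp
    next
      case False
      then have "(\<Sum>x\<in>I. 1 * ?e f g x q) = 0"
        by (intro sum.neutral) simp
      then show ?thesis by simp
    qed
    then show ?thesis
      by (intro exI[of _ "\<lambda>_. 1"]) simp
  qed
qed

text \<open>Written as a sum of indicators over a colour class, so that the weight sums preserved by
  recolouring apply to degrees.\<close>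

definition deg :: "'a set set \<Rightarrow> ('a set \<Rightarrow> 'c) \<Rightarrow> 'c \<Rightarrow> 'a \<Rightarrow> nat" where
  "deg F \<gamma> q x = (\<Sum>E | E \<in> F \<and> \<gamma> E = q. of_bool (x \<in> E))"

lemma deg_eq_card: "finite F \<Longrightarrow> deg F \<gamma> q x = card {E \<in> F. \<gamma> E = q \<and> x \<in> E}"
  unfolding deg_def by (simp add: sum.If_cases of_bool_def Int_def conj_assoc)

lemma transpose_image_image [simp]: "transpose u v ` transpose u v ` E = E"
  by (simp add: image_image)

lemma mem_transpose_image_iff: "x \<in> transpose u v ` E \<longleftrightarrow> transpose u v x \<in> E"
  by (metis image_iff transpose_involutory)

text \<open>Join the colours of \<open>E\<close> and of its transposed set by an arc for each \<open>E\<close> containing \<open>u\<close> but not \<open>v\<close>;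
  reversing an arc exchanges the two colours. An orientation balanced at every colour balances the
  degrees of \<open>u\<close> and \<open>v\<close> in every colour class.\<close>

lemma recolour_pair:
  fixes F :: "'a set set" and \<gamma> :: "'a set \<Rightarrow> 'c"
  assumes F: "finite F" "\<And>E. E \<in> F \<Longrightarrow> transpose u v ` E \<in> F"
  obtains \<gamma>' where "\<gamma>' ` F \<subseteq> \<gamma> ` F"
    "\<And>w :: 'a set \<Rightarrow> nat. \<And>q. (\<And>E. E \<in> F \<Longrightarrow> w (transpose u v ` E) = w E) \<Longrightarrow>
       (\<Sum>E | E \<in> F \<and> \<gamma>' E = q. w E) = (\<Sum>E | E \<in> F \<and> \<gamma> E = q. w E)"
    "\<And>q. \<bar>int (deg F \<gamma>' q u) - int (deg F \<gamma>' q v)\<bar> \<le> 1"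
proof -
  define \<tau> where "\<tau> = (\<lambda>E. transpose u v ` E)"
  have \<tau>: "\<tau> (\<tau> E) = E" "E \<in> F \<Longrightarrow> \<tau> E \<in> F" for E
    using F by (auto simp: \<tau>_def)
  have mem: "u \<in> \<tau> E \<longleftrightarrow> v \<in> E" "v \<in> \<tau> E \<longleftrightarrow> u \<in> E" for E
    by (simp_all add: \<tau>_def mem_transpose_image_iff)
  define I where "I = {E \<in> F. u \<in> E \<and> v \<notin> E}"
  have "finite I" using F by (simp add: I_def)
  from balanced_orientation[OF this, of \<gamma> "\<gamma> \<circ> \<tau>"] obtain \<sigma> :: "'a set \<Rightarrow> int"
    where \<sigma>: "\<And>i. \<sigma> i = 1 \<or> \<sigma> i = -1"
      "\<And>q. \<bar>\<Sum>E\<in>I. \<sigma> E * (of_bool (\<gamma> E = q) - of_bool (\<gamma> (\<tau> E) = q))\<bar> \<le> 1"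
    by auto
  \<comment> \<open>\<open>B\<close> marks both members of each reversed pair, which makes the
    exchange \<open>\<rho>\<close> an involution.\<close>
  define B where "B E \<longleftrightarrow> E \<in> I \<and> \<sigma> E = -1 \<or> \<tau> E \<in> I \<and> \<sigma> (\<tau> E) = -1" for E
  define \<rho> where "\<rho> E = (if B E then \<tau> E else E)" for E
  have "B (\<tau> E) = B E" for E
    by (auto simp: B_def \<tau>)
  then have \<rho>: "\<rho> (\<rho> E) = E" "E \<in> F \<Longrightarrow> \<rho> E \<in> F" for E
    by (auto simp: \<rho>_def \<tau>)
  show thesis
  proof (rule that[of "\<gamma> \<circ> \<rho>"])
    show "(\<gamma> \<circ> \<rho>) ` F \<subseteq> \<gamma> ` F"
      using \<rho> by auto
    show "(\<Sum>E | E \<in> F \<and> (\<gamma> \<circ> \<rho>) E = q. w E) = (\<Sum>E | E \<in> F \<and> \<gamma> E = q. w E)"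
      if "\<And>E. E \<in> F \<Longrightarrow> w (transpose u v ` E) = w E" for w :: "'a set \<Rightarrow> nat" and q
    proof (rule sum.reindex_bij_witness[of _ \<rho> \<rho>])
      fix E assume "E \<in> {E. E \<in> F \<and> (\<gamma> \<circ> \<rho>) E = q}"
      then show "w (\<rho> E) = w E"
        using that by (auto simp: \<rho>_def \<tau>_def)
    qed (auto simp: \<rho>)
    show "\<bar>int (deg F (\<gamma> \<circ> \<rho>) q u) - int (deg F (\<gamma> \<circ> \<rho>) q v)\<bar> \<le> 1" for q
    proof -
      let ?b = "\<lambda>E. of_bool (\<gamma> (\<rho> E) = q) :: int"
      have deg: "int (deg F (\<gamma> \<circ> \<rho>) q x) = (\<Sum>E\<in>F. ?b E * of_bool (x \<in> E))" for x
        unfolding deg_def of_nat_sum by (subst sum.inter_filter[OF F(1)]) (auto intro!: sum.cong)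
      define J where "J = {E \<in> F. v \<in> E \<and> u \<notin> E}"
      have "int (deg F (\<gamma> \<circ> \<rho>) q u) - int (deg F (\<gamma> \<circ> \<rho>) q v)
          = (\<Sum>E\<in>F. (if u \<in> E \<and> v \<notin> E then ?b E else 0) - (if v \<in> E \<and> u \<notin> E then ?b E else 0))"
        unfolding deg sum_subtractf[symmetric] by (rule sum.cong) auto
      also have "\<dots> = (\<Sum>E\<in>I. ?b E) - (\<Sum>E\<in>J. ?b E)"
        unfolding sum_subtractf I_def J_def by (simp only: sum.inter_filter[OF F(1)])
      also have "(\<Sum>E\<in>J. ?b E) = (\<Sum>E\<in>I. ?b (\<tau> E))"
        by (rule sum.reindex_bij_witness[of _ \<tau> \<tau>]) (auto simp: \<tau> I_def J_def mem)
      also have "(\<Sum>E\<in>I. ?b E) - \<dots> = (\<Sum>E\<in>I. \<sigma> E * (of_bool (\<gamma> E = q) - of_bool (\<gamma> (\<tau> E) = q)))"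
        unfolding sum_subtractf[symmetric]
      proof (rule sum.cong)
        fix E assume E: "E \<in> I"
        then have "\<tau> E \<notin> I"
          by (auto simp: I_def mem)
        then have "B E \<longleftrightarrow> \<sigma> E = -1" "B (\<tau> E) \<longleftrightarrow> \<sigma> E = -1"
          using E by (auto simp: B_def \<tau>)
        then show "?b E - ?b (\<tau> E) = \<sigma> E * (of_bool (\<gamma> E = q) - of_bool (\<gamma> (\<tau> E) = q))"
          using \<sigma>(1)[of E] by (auto simp: \<rho>_def \<tau>)
      qed simp
      finally show ?thesis
        using \<sigma>(2)[of q] by (simp only:)
    qed
  qed
qed

text \<open>For a fixed sum, the sum of squares grows with the difference. If \<open>a = b\<close>,
  parity forces \<open>a' = b'\<close>; otherwise the old difference is already at least
  \<open>1\<close>.\<close>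

lemma squares_balanced:
  fixes a b a' b' :: nat
  assumes "a' + b' = a + b" "\<bar>int a' - int b'\<bar> \<le> 1"
  shows "a'\<^sup>2 + b'\<^sup>2 \<le> a\<^sup>2 + b\<^sup>2" "b + 2 \<le> a \<Longrightarrow> a'\<^sup>2 + b'\<^sup>2 < a\<^sup>2 + b\<^sup>2"
proof -
  have *: "2 * ((int x)\<^sup>2 + (int y)\<^sup>2) = (int x + int y)\<^sup>2 + (int x - int y)\<^sup>2" for x y
    by (simp add: power2_eq_square algebra_simps)
  have s: "int a' + int b' = int a + int b" using assms by linarith
  have d: "(int a' - int b')\<^sup>2 \<le> 1" using assms(2) by (simp add: abs_square_le_1)
  have "(int a' - int b')\<^sup>2 \<le> (int a - int b)\<^sup>2"
  proof (cases "a = b")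
    case True
    then have "even (int a' - int b')" using s by presburger
    then have "int a' - int b' = 0" using assms(2) by presburger
    then show ?thesis by simp
  next
    case False
    then have "1 \<le> (int a - int b)\<^sup>2"
      by (simp add: int_one_le_iff_zero_less)
    then show ?thesis using d by linarith
  qed
  then have "(int a')\<^sup>2 + (int b')\<^sup>2 \<le> (int a)\<^sup>2 + (int b)\<^sup>2"
    using *[of a' b'] *[of a b] s by simp
  then show "a'\<^sup>2 + b'\<^sup>2 \<le> a\<^sup>2 + b\<^sup>2"
    by (metis (mono_tags) of_nat_add of_nat_le_iff of_nat_power)
  assume "b + 2 \<le> a"
  then have "2\<^sup>2 \<le> (int a - int b)\<^sup>2"
    by (intro power_mono) auto
  then have "(int a')\<^sup>2 + (int b')\<^sup>2 < (int a)\<^sup>2 + (int b)\<^sup>2"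
    using *[of a' b'] *[of a b] s d by simp
  then show "a'\<^sup>2 + b'\<^sup>2 < a\<^sup>2 + b\<^sup>2"
    by (metis (mono_tags) of_nat_add of_nat_less_iff of_nat_power)
qed

text \<open>Bryant's theorem on almost regular edge colourings. A colouring with the prescribed invariant sums
  that minimises the sum of the squared degrees over \<open>S\<close> is almost regular on \<open>S\<close>, since \<open>recolour_pair\<close>
  would otherwise decrease it.\<close>

lemma almost_regular_recolouring:
  fixes F :: "'a set set" and \<gamma> :: "'a set \<Rightarrow> 'c"
  assumes F: "finite F" "finite S"
    and sym: "\<And>u v E. u \<in> S \<Longrightarrow> v \<in> S \<Longrightarrow> E \<in> F \<Longrightarrow> transpose u v ` E \<in> F"
  obtains \<gamma>' where
    "\<And>w :: 'a set \<Rightarrow> nat. \<And>q. (\<And>u v E. u \<in> S \<Longrightarrow> v \<in> S \<Longrightarrow> E \<in> F \<Longrightarrow> w (transpose u v ` E) = w E) \<Longrightarrow>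
       (\<Sum>E | E \<in> F \<and> \<gamma>' E = q. w E) = (\<Sum>E | E \<in> F \<and> \<gamma> E = q. w E)"
    "\<And>q u v. u \<in> S \<Longrightarrow> v \<in> S \<Longrightarrow> deg F \<gamma>' q u \<le> deg F \<gamma>' q v + 1"
proof -
  define inv where "inv w \<longleftrightarrow> (\<forall>u\<in>S. \<forall>v\<in>S. \<forall>E\<in>F. w (transpose u v ` E) = w E)" for w :: "'a set \<Rightarrow> nat"
  define good where "good \<gamma>' \<longleftrightarrow> \<gamma>' ` F \<subseteq> \<gamma> ` F \<and> (\<forall>w q. inv w \<longrightarrow>
    (\<Sum>E | E \<in> F \<and> \<gamma>' E = q. w E) = (\<Sum>E | E \<in> F \<and> \<gamma> E = q. w E))" for \<gamma>'
  define \<Phi> where "\<Phi> \<gamma>' = (\<Sum>q\<in>\<gamma> ` F. \<Sum>x\<in>S. (deg F \<gamma>' q x)\<^sup>2)" for \<gamma>'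
  have "good \<gamma>" by (simp add: good_def)
  then obtain \<gamma>' where \<gamma>': "good \<gamma>'" "\<And>\<delta>. good \<delta> \<Longrightarrow> \<Phi> \<gamma>' \<le> \<Phi> \<delta>"
    using ex_has_least_nat[of good \<gamma> \<Phi>] by auto
  have deg: "deg F \<gamma>' q u \<le> deg F \<gamma>' q v + 1" if uv: "u \<in> S" "v \<in> S" for q u v
  proof (rule ccontr)
    assume "\<not> deg F \<gamma>' q u \<le> deg F \<gamma>' q v + 1"
    then have gt: "deg F \<gamma>' q v + 2 \<le> deg F \<gamma>' q u" by simp
    then have "u \<noteq> v" by auto
    obtain \<delta> where \<delta>: "\<delta> ` F \<subseteq> \<gamma>' ` F"
      "\<And>w :: 'a set \<Rightarrow> nat. \<And>q. (\<And>E. E \<in> F \<Longrightarrow> w (transpose u v ` E) = w E) \<Longrightarrow>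
         (\<Sum>E | E \<in> F \<and> \<delta> E = q. w E) = (\<Sum>E | E \<in> F \<and> \<gamma>' E = q. w E)"
      "\<And>q. \<bar>int (deg F \<delta> q u) - int (deg F \<delta> q v)\<bar> \<le> 1"
    proof (rule recolour_pair[OF F(1) sym[OF uv], of \<gamma>'], assumption, goal_cases)
      case (1 \<delta>)
      show ?case by (rule that; fact 1)
    qed
    have "good \<delta>"
      unfolding good_def
    proof (intro conjI allI impI)
      show "\<delta> ` F \<subseteq> \<gamma> ` F"
        using \<gamma>'(1) \<delta>(1) unfolding good_def by blast
      fix w q assume w: "inv w"
      then have "(\<Sum>E | E \<in> F \<and> \<delta> E = q. w E) = (\<Sum>E | E \<in> F \<and> \<gamma>' E = q. w E)"
        using uv by (intro \<delta>(2)) (simp add: inv_def)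
      also have "\<dots> = (\<Sum>E | E \<in> F \<and> \<gamma> E = q. w E)"
        using \<gamma>'(1) w unfolding good_def by blast
      finally show "(\<Sum>E | E \<in> F \<and> \<delta> E = q. w E) = (\<Sum>E | E \<in> F \<and> \<gamma> E = q. w E)" .
    qed
    \<comment> \<open>The membership indicator of any other point, and the sum of the indicators of
      \<open>u\<close> and \<open>v\<close>, are invariant under swapping \<open>u\<close> and
      \<open>v\<close>; so \<open>\<Phi>\<close> changes only through the degrees of these
      two.\<close>
    have other: "deg F \<delta> q x = deg F \<gamma>' q x" if "x \<noteq> u" "x \<noteq> v" for q x
      unfolding deg_def by (rule \<delta>(2)) (use that in \<open>simp add: mem_transpose_image_iff\<close>)
    have total: "deg F \<delta> q u + deg F \<delta> q v = deg F \<gamma>' q u + deg F \<gamma>' q v" for q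
      unfolding deg_def sum.distrib[symmetric] by (rule \<delta>(2)) (simp add: mem_transpose_image_iff)
    have split: "(\<Sum>x\<in>S. (deg F \<beta> q x)\<^sup>2)
        = (deg F \<beta> q u)\<^sup>2 + (deg F \<beta> q v)\<^sup>2 + (\<Sum>x\<in>S - {u} - {v}. (deg F \<beta> q x)\<^sup>2)" for \<beta> :: "'a set \<Rightarrow> 'c" and q
      using uv F(2) \<open>u \<noteq> v\<close> by (subst sum.remove[of S u], simp, simp, subst sum.remove[of "S - {u}" v]) auto
    have rest: "(\<Sum>x\<in>S - {u} - {v}. (deg F \<delta> q x)\<^sup>2) = (\<Sum>x\<in>S - {u} - {v}. (deg F \<gamma>' q x)\<^sup>2)" for q
      by (rule sum.cong) (auto simp: other)
    \<comment> \<open>\<open>\<Phi>\<close> sums only over the original colours; a positive degree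
      shows that \<open>q\<close> is one of them.\<close>
    have "deg F \<gamma>' q u \<noteq> 0" using gt by linarith
    then have "{E \<in> F. \<gamma>' E = q \<and> u \<in> E} \<noteq> {}"
      using deg_eq_card[OF F(1)] by (metis card.empty)
    then have "q \<in> \<gamma> ` F"
      using \<gamma>'(1) by (auto simp: good_def)
    moreover have "(\<Sum>x\<in>S. (deg F \<delta> p x)\<^sup>2) \<le> (\<Sum>x\<in>S. (deg F \<gamma>' p x)\<^sup>2)" for p
      using squares_balanced(1)[OF total \<delta>(3)] unfolding split rest by simp
    moreover have "(\<Sum>x\<in>S. (deg F \<delta> q x)\<^sup>2) < (\<Sum>x\<in>S. (deg F \<gamma>' q x)\<^sup>2)"
      using squares_balanced(2)[OF total \<delta>(3) gt] unfolding split rest by simp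
    ultimately have "\<Phi> \<delta> < \<Phi> \<gamma>'"
      unfolding \<Phi>_def using F(1) by (intro sum_strict_mono_ex1) auto
    then show False
      using \<gamma>'(2)[OF \<open>good \<delta>\<close>] by simp
  qed
  have sums: "(\<Sum>E | E \<in> F \<and> \<gamma>' E = q. w E) = (\<Sum>E | E \<in> F \<and> \<gamma> E = q. w E)"
    if "\<And>u v E. u \<in> S \<Longrightarrow> v \<in> S \<Longrightarrow> E \<in> F \<Longrightarrow> w (transpose u v ` E) = w E" for w :: "'a set \<Rightarrow> nat" and q
    using \<gamma>'(1) that unfolding good_def inv_def by blast
  show thesis
    by (rule that; fact sums deg)
qed

subsection \<open>Partitions from types\<close>

lemma card_transpose_image_Int:
  assumes "u \<in> S \<longleftrightarrow> v \<in> S"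
  shows "card (transpose u v ` E \<inter> S) = card (E \<inter> S)"
proof -
  have "transpose u v ` S = S"
    using assms by (cases "u \<in> S") (auto simp: image_iff transpose_def)
  then have "transpose u v ` E \<inter> S = transpose u v ` (E \<inter> S)"
    by (metis image_Int inj_transpose)
  then show ?thesis
    by (simp add: card_image inj_on_subset[OF inj_transpose])
qed

lemma card_transpose_image: "card (transpose u v ` E) = card E"
  by (simp add: card_image inj_on_subset[OF inj_transpose])

lemma transpose_image_subset:
  "u \<in> V \<Longrightarrow> v \<in> V \<Longrightarrow> E \<subseteq> V \<Longrightarrow> transpose u v ` E \<subseteq> V"
  by (auto simp: transpose_def)

text \<open>A value \<open>0\<close> would force all values to be at most \<open>1\<close>, and a
  value of at least \<open>2\<close> would force all to be at least \<open>1\<close>; either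
  contradicts the average \<open>1\<close>.\<close>

lemma eq_1_if_almost_regular:
  fixes d :: "'a \<Rightarrow> nat"
  assumes "finite S" "sum d S = card S" "\<And>u v. u \<in> S \<Longrightarrow> v \<in> S \<Longrightarrow> d u \<le> d v + 1" "x \<in> S"
  shows "d x = 1"
proof (rule ccontr)
  assume "d x \<noteq> 1"
  then consider "d x = 0" | "d x \<ge> 2" by linarith
  then show False
  proof cases
    case 1
    then have "sum d S < (\<Sum>y\<in>S. 1)"
      using assms(3)[OF _ assms(4)] assms(1,4) by (intro sum_strict_mono_ex1) auto
    then show ?thesis using assms(2) by simp
  next
    case 2
    then have "1 \<le> d y" if "y \<in> S" for y
      using assms(3)[OF assms(4) that] by linarith
    moreover have "\<exists>y\<in>S. 1 < d y"
      using 2 assms(4) by (intro bexI[of _ x]) auto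
    ultimately have "(\<Sum>y\<in>S. 1) < sum d S"
      using assms(1) by (intro sum_strict_mono_ex1) auto
    then show ?thesis using assms(2) by simp
  qed
qed

lemma sum_deg:
  assumes "finite F" "finite S"
  shows "(\<Sum>x\<in>S. deg F \<gamma> q x) = (\<Sum>E | E \<in> F \<and> \<gamma> E = q. card (E \<inter> S))"
  unfolding deg_def using assms
  by (subst sum.swap) (auto simp: of_bool_def sum.If_cases Int_def intro!: sum.cong arg_cong[where f = card])

text \<open>The \<open>q\<close>-th intended partition consists of the sets \<open>\<phi> q t\<close>, which need only have the right total
  intersections with \<open>S\<close> and \<open>T\<close>; recolouring on \<open>S\<close> and then on \<open>T\<close> turns them into partitions.\<close>

lemma card_le_SP_if_almost_factors:
  fixes F :: "'a set set" and \<phi> :: "nat \<Rightarrow> nat \<Rightarrow> 'a set"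
  assumes fin: "finite S" "finite T" and disj: "S \<inter> T = {}" and k: "k > 0"
    and F: "F \<subseteq> Pow (S \<union> T)" "{} \<notin> F" "\<And>A B. A \<in> F \<Longrightarrow> B \<in> F \<Longrightarrow> A \<subseteq> B \<Longrightarrow> A = B"
    and sym: "\<And>u v E. u \<in> S \<Longrightarrow> v \<in> S \<Longrightarrow> E \<in> F \<Longrightarrow> transpose u v ` E \<in> F"
      "\<And>u v E. u \<in> T \<Longrightarrow> v \<in> T \<Longrightarrow> E \<in> F \<Longrightarrow> transpose u v ` E \<in> F"
    and \<phi>: "\<And>q t. q < p \<Longrightarrow> t < k \<Longrightarrow> \<phi> q t \<in> F"
      "inj_on (\<lambda>(q, t). \<phi> q t) ({..<p} \<times> {..<k})"
    and total: "\<And>q. q < p \<Longrightarrow> (\<Sum>t<k. card (\<phi> q t \<inter> S)) = card S"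
      "\<And>q. q < p \<Longrightarrow> (\<Sum>t<k. card (\<phi> q t \<inter> T)) = card T"
  shows "p \<le> SP (card (S \<union> T)) k"
proof -
  have finF: "finite F"
    using F(1) fin by (meson finite_Pow_iff finite_UnI finite_subset)
  \<comment> \<open>Sets outside all intended partitions get the spare colour
    \<open>p\<close>.\<close>
  define \<gamma>\<^sub>0 where "\<gamma>\<^sub>0 E = (if \<exists>q<p. \<exists>t<k. E = \<phi> q t then SOME q. q < p \<and> (\<exists>t<k. E = \<phi> q t) else p)" for E
  have inj: "q = q' \<and> t = t'" if "q < p" "q' < p" "t < k" "t' < k" "\<phi> q t = \<phi> q' t'" for q q' t t'
    using inj_onD[OF \<phi>(2), of "(q, t)" "(q', t')"] that by auto
  have \<gamma>\<^sub>0: "{E. E \<in> F \<and> \<gamma>\<^sub>0 E = q} = \<phi> q ` {..<k}" if "q < p" for q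
  proof -
    have "\<gamma>\<^sub>0 (\<phi> q' t) = q'" if "q' < p" "t < k" for q' t
      unfolding \<gamma>\<^sub>0_def using that inj by (auto intro!: some_equality)
    moreover have "\<exists>t<k. E = \<phi> (\<gamma>\<^sub>0 E) t" if "\<gamma>\<^sub>0 E < p" for E
    proof -
      have ex: "\<exists>q<p. \<exists>t<k. E = \<phi> q t"
        using that by (auto simp: \<gamma>\<^sub>0_def split: if_splits)
      then show ?thesis
        using someI_ex[OF ex] unfolding \<gamma>\<^sub>0_def by auto
    qed
    ultimately show ?thesis
      using that \<phi>(1) by (intro equalityI subsetI) (fastforce simp: image_iff)+
  qed
  have sum\<^sub>0: "(\<Sum>E | E \<in> F \<and> \<gamma>\<^sub>0 E = q. w E) = (\<Sum>t<k. w (\<phi> q t))" if "q < p" for w :: "'a set \<Rightarrow> nat" and q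
    unfolding \<gamma>\<^sub>0[OF that] using inj that by (subst sum.reindex) (auto intro!: inj_onI)
  obtain \<gamma>\<^sub>1 where sum\<^sub>1: "\<And>w :: 'a set \<Rightarrow> nat. \<And>q. (\<And>u v E. u \<in> S \<Longrightarrow> v \<in> S \<Longrightarrow> E \<in> F \<Longrightarrow> w (transpose u v ` E) = w E) \<Longrightarrow>
       (\<Sum>E | E \<in> F \<and> \<gamma>\<^sub>1 E = q. w E) = (\<Sum>E | E \<in> F \<and> \<gamma>\<^sub>0 E = q. w E)"
    and reg\<^sub>1: "\<And>q u v. u \<in> S \<Longrightarrow> v \<in> S \<Longrightarrow> deg F \<gamma>\<^sub>1 q u \<le> deg F \<gamma>\<^sub>1 q v + 1"
  proof (rule almost_regular_recolouring[OF finF fin(1) sym(1), of \<gamma>\<^sub>0], assumption+, goal_cases)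
    case (1 \<gamma>)
    show ?case by (rule that; fact 1)
  qed
  obtain \<gamma>\<^sub>2 where sum\<^sub>2: "\<And>w :: 'a set \<Rightarrow> nat. \<And>q. (\<And>u v E. u \<in> T \<Longrightarrow> v \<in> T \<Longrightarrow> E \<in> F \<Longrightarrow> w (transpose u v ` E) = w E) \<Longrightarrow>
       (\<Sum>E | E \<in> F \<and> \<gamma>\<^sub>2 E = q. w E) = (\<Sum>E | E \<in> F \<and> \<gamma>\<^sub>1 E = q. w E)"
    and reg\<^sub>2: "\<And>q u v. u \<in> T \<Longrightarrow> v \<in> T \<Longrightarrow> deg F \<gamma>\<^sub>2 q u \<le> deg F \<gamma>\<^sub>2 q v + 1"
  proof (rule almost_regular_recolouring[OF finF fin(2) sym(2), of \<gamma>\<^sub>1], assumption+, goal_cases)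
    case (1 \<gamma>)
    show ?case by (rule that; fact 1)
  qed
  have deg_S: "deg F \<gamma>\<^sub>2 q x = 1" if "q < p" "x \<in> S" for q x
  proof -
    have "(\<Sum>x\<in>S. deg F \<gamma>\<^sub>1 q x) = card S"
      unfolding sum_deg[OF finF fin(1)] using total(1) that(1)
      by (subst sum\<^sub>1) (auto simp: sum\<^sub>0 card_transpose_image_Int)
    then have "deg F \<gamma>\<^sub>1 q x = 1"
      by (rule eq_1_if_almost_regular[OF fin(1) _ _ that(2)]) (rule reg\<^sub>1)
    \<comment> \<open>Transpositions inside \<open>T\<close> fix \<open>x\<close>, so the second
      recolouring keeps the degrees that the first made equal to \<open>1\<close>.\<close>
    moreover have "deg F \<gamma>\<^sub>2 q x = deg F \<gamma>\<^sub>1 q x"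
      unfolding deg_def
    proof (rule sum\<^sub>2)
      fix u v E assume "u \<in> T" "v \<in> T"
      then have "x \<noteq> u" "x \<noteq> v" using disj that by auto
      then show "of_bool (x \<in> transpose u v ` E) = (of_bool (x \<in> E) :: nat)"
        by (simp add: mem_transpose_image_iff)
    qed
    ultimately show ?thesis by simp
  qed
  have deg_T: "deg F \<gamma>\<^sub>2 q x = 1" if "q < p" "x \<in> T" for q x
  proof -
    have notin: "u \<notin> T" if "u \<in> S" for u using disj that by auto
    have "(\<Sum>x\<in>T. deg F \<gamma>\<^sub>2 q x) = (\<Sum>E | E \<in> F \<and> \<gamma>\<^sub>1 E = q. card (E \<inter> T))"
      unfolding sum_deg[OF finF fin(2)] by (rule sum\<^sub>2) (simp add: card_transpose_image_Int)
    also have "\<dots> = (\<Sum>E | E \<in> F \<and> \<gamma>\<^sub>0 E = q. card (E \<inter> T))"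
      by (rule sum\<^sub>1) (simp add: card_transpose_image_Int notin)
    also have "\<dots> = card T"
      using total(2) that(1) by (simp add: sum\<^sub>0)
    finally show ?thesis
      by (rule eq_1_if_almost_regular[OF fin(2) _ _ that(2)]) (rule reg\<^sub>2)
  qed
  define P where "P q = {E \<in> F. \<gamma>\<^sub>2 E = q}" for q
  have ex1: "\<exists>!E. E \<in> P q \<and> x \<in> E" if "q < p" "x \<in> S \<union> T" for q x
  proof -
    have "card {E \<in> F. \<gamma>\<^sub>2 E = q \<and> x \<in> E} = 1"
      using deg_S deg_T that by (auto simp: deg_eq_card[OF finF, symmetric])
    then obtain E where "{E \<in> F. \<gamma>\<^sub>2 E = q \<and> x \<in> E} = {E}"
      by (rule card_1_singletonE)
    then show ?thesis
      unfolding P_def by (intro ex1I[of _ E]) auto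
  qed
  have card_P: "card (P q) = k" if "q < p" for q
  proof -
    have "card (P q) = (\<Sum>E | E \<in> F \<and> \<gamma>\<^sub>2 E = q. 1)" by (simp add: P_def)
    also have "\<dots> = (\<Sum>E | E \<in> F \<and> \<gamma>\<^sub>1 E = q. 1)" by (rule sum\<^sub>2) simp
    also have "\<dots> = (\<Sum>E | E \<in> F \<and> \<gamma>\<^sub>0 E = q. 1)" by (rule sum\<^sub>1) simp
    also have "\<dots> = k" using sum\<^sub>0[OF that, of "\<lambda>_. 1"] by simp
    finally show ?thesis .
  qed
  have part: "partition_on (S \<union> T) (P q)" if "q < p" for q
  proof (rule partition_onI)
    show "\<Union> (P q) = S \<union> T"
      using ex1[OF that] F(1) unfolding P_def by blast
    show "{} \<notin> P q"
      using F(2) by (simp add: P_def)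
    fix A B assume AB: "A \<in> P q" "B \<in> P q" "A \<noteq> B"
    then have "A \<subseteq> S \<union> T" using F(1) by (auto simp: P_def)
    then show "disjnt A B"
      using AB ex1[OF that] unfolding disjnt_iff by blast
  qed
  have disjoint: "P q \<inter> P q' = {}" if "q \<noteq> q'" for q q'
    using that by (auto simp: P_def)
  have "inj_on P {..<p}"
  proof (rule inj_onI, rule ccontr)
    fix q q' assume "q \<in> {..<p}" "P q = P q'" "q \<noteq> q'"
    then show False
      using disjoint[of q q'] card_P[of q] k by auto
  qed
  then have "p = card (P ` {..<p})" by (simp add: card_image)
  also have "\<dots> \<le> SP (card (S \<union> T)) k"
  proof (rule SP_upper)
    have "\<not> A \<subseteq> B" if "q < p" "q' < p" "P q \<noteq> P q'" "A \<in> P q" "B \<in> P q'" for q q' A B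
    proof
      assume "A \<subseteq> B"
      then have "A = B"
        using that F(3) by (simp add: P_def)
      then show False
        using that disjoint[of q q'] by auto
    qed
    then show "sperner_partition_system (card (S \<union> T)) k (P ` {..<p})"
      unfolding sperner_partition_system_def using part card_P fin
      by (intro exI[of _ "S \<union> T"]) auto
  qed
  finally show ?thesis .
qed

text \<open>As the sets \<open>G y\<close> are disjoint, injections on the single fibres of
  \<open>f\<close> combine to a global one.\<close>

lemma ex_inj_selection:
  assumes "finite I" "\<And>i. i \<in> I \<Longrightarrow> finite (G (f i))"
    and "\<And>i. i \<in> I \<Longrightarrow> card {j \<in> I. f j = f i} \<le> card (G (f i))"
    and "\<And>y z. y \<noteq> z \<Longrightarrow> G y \<inter> G z = {}"
  obtains \<phi> where "inj_on \<phi> I" "\<And>i. i \<in> I \<Longrightarrow> \<phi> i \<in> G (f i)"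
proof -
  have "\<exists>h. inj_on h {j \<in> I. f j = y} \<and> h ` {j \<in> I. f j = y} \<subseteq> G y" if "y \<in> f ` I" for y
    using card_le_inj[of "{j \<in> I. f j = y}" "G y"] assms(1-3) that by auto
  then obtain h where h: "\<And>y. y \<in> f ` I \<Longrightarrow> inj_on (h y) {j \<in> I. f j = y}"
      "\<And>y. y \<in> f ` I \<Longrightarrow> h y ` {j \<in> I. f j = y} \<subseteq> G y"
    by metis
  show thesis
  proof (rule that[of "\<lambda>i. h (f i) i"])
    show mem: "h (f i) i \<in> G (f i)" if "i \<in> I" for i
      using h(2)[of "f i"] that by blast
    show "inj_on (\<lambda>i. h (f i) i) I"
    proof (rule inj_onI)
      fix i j assume ij: "i \<in> I" "j \<in> I" "h (f i) i = h (f j) j"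
      then have "f i = f j"
        using mem[of i] mem[of j] assms(4)[of "f i" "f j"] by auto
      then show "i = j"
        using ij inj_onD[OF h(1)[of "f i"], of i j] by auto
    qed
  qed
qed

text \<open>With \<open>T\<close> empty, the \<open>c\<close>-sets can be dealt out to the places in
  any injective way, as \<open>k\<close> sets of size \<open>c\<close> always have total size
  \<open>c * k\<close>.\<close>

lemma SP_ge_binomial_div:
  assumes "c > 0" "k > 0"
  shows "(c * k choose c) div k \<le> SP (c * k) k"
proof -
  let ?V = "{..<c * k}"
  let ?p = "(c * k choose c) div k"
  let ?F = "{E. E \<subseteq> ?V \<and> card E = c}"
  have finF: "finite ?F" by simp
  have cF: "card ?F = c * k choose c" using n_subsets[of ?V c] by simp
  have "card ({..<?p} \<times> {..<k}) \<le> card ?F"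
    unfolding cF by simp
  then obtain \<phi> where \<phi>: "\<phi> ` ({..<?p} \<times> {..<k}) \<subseteq> ?F" "inj_on \<phi> ({..<?p} \<times> {..<k})"
    using card_le_inj[OF _ finF, of "{..<?p} \<times> {..<k}"] by auto
  have mem: "\<phi> (q, t) \<in> ?F" if "q < ?p" "t < k" for q t
    using \<phi>(1) that by blast
  have "?p \<le> SP (card (?V \<union> {})) k"
  proof (rule card_le_SP_if_almost_factors[where F = ?F and \<phi> = "\<lambda>q t. \<phi> (q, t)"])
    show "A = B" if "A \<in> ?F" "B \<in> ?F" "A \<subseteq> B" for A B
      using that by (metis (lifting) card_subset_eq finite_lessThan finite_subset mem_Collect_eq)
    show "transpose u v ` E \<in> ?F" if "u \<in> ?V" "v \<in> ?V" "E \<in> ?F" for u v E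
      using that by (simp add: card_transpose_image transpose_image_subset)
    show "(\<Sum>t<k. card (\<phi> (q, t) \<inter> ?V)) = card ?V" if "q < ?p" for q
    proof -
      have "card (\<phi> (q, t) \<inter> ?V) = c" if "t < k" for t
        using mem[OF \<open>q < ?p\<close> that] by (simp add: Int_absorb2)
      then show ?thesis by simp
    qed
  qed (use assms mem \<phi>(2) in \<open>auto simp: case_prod_unfold\<close>)
  then show ?thesis by simp
qed

text \<open>The type of a set is the size of its intersection with one half of the ground set. Here \<open>\<tau> q t\<close> is
  the type of the \<open>t\<close>-th of the \<open>s\<close> classes of size \<open>e\<close> in partition \<open>q\<close>, there are \<open>N i\<close> sets of type \<open>i\<close>,
  and only types in \<open>R\<close> are allowed.\<close>

definition type_assignment :: "(nat \<Rightarrow> nat) \<Rightarrow> nat \<Rightarrow> nat \<Rightarrow> nat set \<Rightarrow> nat \<Rightarrow> (nat \<Rightarrow> nat \<Rightarrow> nat) \<Rightarrow> bool" where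
  "type_assignment N s e R p \<tau> \<longleftrightarrow>
     (\<forall>q<p. 2 * (\<Sum>t<s. \<tau> q t) = s * e \<and> (\<forall>t<s. \<tau> q t \<in> R)) \<and>
     (\<forall>i\<in>R. card {(q, t). q < p \<and> t < s \<and> \<tau> q t = i} \<le> N i)"

text \<open>The number of \<open>e\<close>-sets of type \<open>i\<close> when both halves have size \<open>h\<close>; only meaningful for \<open>i \<le> e\<close>, because
  of the truncated subtraction.\<close>

abbreviation split_count :: "nat \<Rightarrow> nat \<Rightarrow> nat \<Rightarrow> nat" where
  "split_count h e i \<equiv> (h choose i) * (h choose (e - i))"

lemma card_sets_of_type:
  assumes "finite S" "finite T" "S \<inter> T = {}" "i \<le> e"
  shows "card {E. E \<subseteq> S \<union> T \<and> card E = e \<and> card (E \<inter> S) = i} = (card S choose i) * (card T choose (e - i))"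
proof -
  have "card {E. E \<subseteq> S \<union> T \<and> card E = e \<and> card (E \<inter> S) = i}
      = card ({A. A \<subseteq> S \<and> card A = i} \<times> {B. B \<subseteq> T \<and> card B = e - i})"
  proof (rule bij_betw_same_card[OF bij_betwI'[of _ "\<lambda>E. (E \<inter> S, E \<inter> T)"]], goal_cases)
    case (1 E E')
    then show ?case by auto
  next
    case (2 E)
    then have "card E = card (E \<inter> S) + card (E \<inter> T)"
      using assms by (subst card_Un_disjoint[symmetric]) (auto intro!: arg_cong[where f = card])
    then show ?case using 2 by auto
  next
    case (3 y)
    then obtain A B where AB: "y = (A, B)" "A \<subseteq> S" "card A = i" "B \<subseteq> T" "card B = e - i" by auto
    then have "card (A \<union> B) = e"
      using assms finite_subset[of A S] finite_subset[of B T] by (subst card_Un_disjoint) auto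
    moreover have "(A \<union> B) \<inter> S = A" "(A \<union> B) \<inter> T = B"
      using AB assms(3) by auto
    ultimately show ?case
      using AB by (intro bexI[of _ "A \<union> B"]) auto
  qed
  then show ?thesis
    using n_subsets[OF assms(1)] n_subsets[OF assms(2)] by (simp add: card_cartesian_product)
qed

lemma sum_lessThan_add:
  fixes g :: "nat \<Rightarrow> 'a::comm_monoid_add"
  shows "(\<Sum>t<a + b. g t) = (\<Sum>t<a. g t) + (\<Sum>t<b. g (a + t))"
  by (induction b) (simp_all add: add.assoc)

text \<open>Adding a point to a \<open>c\<close>-set keeps its type or raises it by one, so the
  conditions on \<open>A\<close> and \<open>B\<close> exclude inclusions. The type sums of the two
  assignments add up to \<open>h\<close>.\<close>

lemma SP_ge_if_type_assignments:
  assumes n: "2 * h = c * k + r" "r < k" "c > 0"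
    and \<alpha>: "type_assignment (split_count h c) (k - r) c A p \<alpha>"
    and \<beta>: "type_assignment (split_count h (c + 1)) r (c + 1) B p \<beta>"
    and AB: "A \<subseteq> {..c}" "B \<subseteq> {..c + 1}" "A \<inter> B = {}" "\<And>i. i \<in> A \<Longrightarrow> Suc i \<notin> B"
  shows "p \<le> SP (2 * h) k"
proof -
  define S T where "S = {..<h}" and "T = {h..<2 * h}"
  have ST: "finite S" "finite T" "S \<inter> T = {}" "card S = h" "card T = h" "S \<union> T = {..<2 * h}"
    by (auto simp: S_def T_def)
  define G where "G = (\<lambda>(e, i). {E. E \<subseteq> S \<union> T \<and> card E = e \<and> card (E \<inter> S) = i})"
  define F where "F = (\<Union>i\<in>A. G (c, i)) \<union> (\<Union>i\<in>B. G (c + 1, i))"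
  have F_iff: "E \<in> F \<longleftrightarrow> E \<subseteq> S \<union> T \<and> (card E = c \<and> card (E \<inter> S) \<in> A \<or> card E = c + 1 \<and> card (E \<inter> S) \<in> B)" for E
    by (auto simp: F_def G_def)
  define f where "f = (\<lambda>(q, t). if t < k - r then (c, \<alpha> q t) else (c + 1, \<beta> q (t - (k - r))))"
  let ?I = "{..<p} \<times> {..<k}"
  have cardG: "card (G (e, i)) = split_count h e i" if "i \<le> e" for e i
    unfolding G_def using card_sets_of_type[OF ST(1-3) that] ST(4,5) by simp
  have \<alpha>R: "\<alpha> q t \<in> A" if "q < p" "t < k - r" for q t
    using \<alpha> that by (simp add: type_assignment_def)
  have \<beta>R: "\<beta> q t \<in> B" if "q < p" "t < r" for q t
    using \<beta> that by (simp add: type_assignment_def)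
  have le: "card {j \<in> ?I. f j = f i} \<le> card (G (f i))" if "i \<in> ?I" for i
  proof -
    obtain q t where i: "i = (q, t)" "q < p" "t < k" using \<open>i \<in> ?I\<close> by (cases i) auto
    show ?thesis
    proof (cases "t < k - r")
      case True
      have "{j \<in> ?I. f j = f i} \<subseteq> {(q', t'). q' < p \<and> t' < k - r \<and> \<alpha> q' t' = \<alpha> q t}"
        using i True by (auto simp: f_def split: if_splits)
      then have "card {j \<in> ?I. f j = f i} \<le> card {(q', t'). q' < p \<and> t' < k - r \<and> \<alpha> q' t' = \<alpha> q t}"
        by (rule card_mono[rotated]) (rule finite_subset[of _ "{..<p} \<times> {..<k}"], auto)
      also have "\<dots> \<le> split_count h c (\<alpha> q t)"
        using \<alpha> \<alpha>R[OF i(2) True] by (simp add: type_assignment_def)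
      also have "\<dots> = card (G (f i))"
        using cardG[of "\<alpha> q t" c] \<alpha>R[OF i(2) True] AB(1) True by (auto simp: f_def i)
      finally show ?thesis .
    next
      case False
      define t0 where "t0 = t - (k - r)"
      have t0: "t0 < r" using i False n(2) by (simp add: t0_def)
      let ?J = "{(q', t'). q' < p \<and> t' < r \<and> \<beta> q' t' = \<beta> q t0}"
      have finJ: "finite ?J" by (rule finite_subset[of _ "{..<p} \<times> {..<r}"]) auto
      have "{j \<in> ?I. f j = f i} \<subseteq> (\<lambda>(q', t'). (q', t' + (k - r))) ` ?J"
      proof
        fix j assume "j \<in> {j \<in> ?I. f j = f i}"
        then obtain q' t' where j: "j = (q', t')" "q' < p" "t' < k" "f j = f i" by auto
        then have "\<not> t' < k - r" "\<beta> q' (t' - (k - r)) = \<beta> q t0"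
          using i False by (auto simp: f_def t0_def split: if_splits)
        then show "j \<in> (\<lambda>(q', t'). (q', t' + (k - r))) ` ?J"
          using j n(2) by (intro image_eqI[of _ _ "(q', t' - (k - r))"]) auto
      qed
      then have "card {j \<in> ?I. f j = f i} \<le> card ?J"
        using finJ by (meson card_image_le card_mono finite_imageI le_trans)
      also have "\<dots> \<le> split_count h (c + 1) (\<beta> q t0)"
        using \<beta> \<beta>R[OF i(2) t0] by (simp add: type_assignment_def)
      also have "\<dots> = card (G (f i))"
        using cardG[of "\<beta> q t0" "c + 1"] \<beta>R[OF i(2) t0] AB(2) False by (auto simp: f_def i t0_def)
      finally show ?thesis .
    qed
  qed
  obtain \<phi> where \<phi>: "inj_on \<phi> ?I" "\<And>i. i \<in> ?I \<Longrightarrow> \<phi> i \<in> G (f i)"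
  proof (rule ex_inj_selection[of ?I G f])
    show "finite (G (f i))" for i
      unfolding G_def using ST(1,2) by (auto simp: case_prod_unfold intro: finite_subset[of _ "Pow (S \<union> T)"])
    show "G y \<inter> G z = {}" if "y \<noteq> z" for y z
      using that by (auto simp: G_def case_prod_unfold prod_eq_iff)
  qed (use le in auto)
  have \<phi>1: "\<phi> (q, t) \<subseteq> S \<union> T" "card (\<phi> (q, t)) = c" "card (\<phi> (q, t) \<inter> S) = \<alpha> q t"
    if "q < p" "t < k - r" for q t
    using \<phi>(2)[of "(q, t)"] that by (auto simp: G_def f_def)
  have \<phi>2: "\<phi> (q, k - r + t) \<subseteq> S \<union> T" "card (\<phi> (q, k - r + t)) = c + 1" "card (\<phi> (q, k - r + t) \<inter> S) = \<beta> q t"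
    if "q < p" "t < r" for q t
  proof -
    have "k - r + t < k" "f (q, k - r + t) = (c + 1, \<beta> q t)"
      using that n(2) by (auto simp: f_def)
    then have "\<phi> (q, k - r + t) \<in> G (c + 1, \<beta> q t)"
      using \<phi>(2)[of "(q, k - r + t)"] that by simp
    then show "\<phi> (q, k - r + t) \<subseteq> S \<union> T" "card (\<phi> (q, k - r + t)) = c + 1"
      "card (\<phi> (q, k - r + t) \<inter> S) = \<beta> q t"
      by (simp_all add: G_def)
  qed
  have split: "(\<Sum>t<k. w (\<phi> (q, t))) = (\<Sum>t<k - r. w (\<phi> (q, t))) + (\<Sum>t<r. w (\<phi> (q, k - r + t)))"
    for w :: "nat set \<Rightarrow> nat" and q
    using sum_lessThan_add[of "\<lambda>t. w (\<phi> (q, t))" "k - r" r] n(2) by simp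
  have tot: "(\<Sum>t<k. card (\<phi> (q, t) \<inter> S)) = h" if "q < p" for q
  proof -
    have "(\<Sum>t<k. card (\<phi> (q, t) \<inter> S)) = (\<Sum>t<k - r. \<alpha> q t) + (\<Sum>t<r. \<beta> q t)"
      using split[of "\<lambda>E. card (E \<inter> S)" q] \<phi>1(3)[OF that] \<phi>2(3)[OF that] by simp
    moreover have "2 * (\<Sum>t<k - r. \<alpha> q t) = (k - r) * c" "2 * (\<Sum>t<r. \<beta> q t) = r * (c + 1)"
      using \<alpha> \<beta> that by (auto simp: type_assignment_def)
    moreover have "(k - r) * c + r * (c + 1) = 2 * h"
      using n(1,2) by (simp add: algebra_simps diff_mult_distrib)
    ultimately show ?thesis by linarith
  qed
  have tot2: "(\<Sum>t<k. card (\<phi> (q, t))) = 2 * h" if "q < p" for q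
  proof -
    have "(\<Sum>t<k. card (\<phi> (q, t))) = (k - r) * c + r * (c + 1)"
      using split[of card q] \<phi>1(2)[OF that] \<phi>2(2)[OF that] by simp
    then show ?thesis
      using n(1,2) by (simp add: algebra_simps diff_mult_distrib)
  qed
  have mem: "\<phi> (q, t) \<in> F" if "q < p" "t < k" for q t
  proof (cases "t < k - r")
    case True
    then show ?thesis using \<phi>1[OF that(1) True] \<alpha>R[OF that(1) True] by (simp add: F_iff)
  next
    case False
    then have "t = k - r + (t - (k - r))" "t - (k - r) < r"
      using \<open>t < k\<close> n(2) by auto
    then show ?thesis
      using \<phi>2[OF \<open>q < p\<close>, of "t - (k - r)"] \<beta>R[OF \<open>q < p\<close>, of "t - (k - r)"] by (simp add: F_iff)
  qed
  have "p \<le> SP (card (S \<union> T)) k"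
  proof (rule card_le_SP_if_almost_factors[where F = F and \<phi> = "\<lambda>q t. \<phi> (q, t)"])
    show "{} \<notin> F" using n(3) by (simp add: F_iff)
    show "X = Y" if XY: "X \<in> F" "Y \<in> F" "X \<subseteq> Y" for X Y
    proof (rule ccontr)
      assume "X \<noteq> Y"
      have finY: "finite Y" using XY(2) ST(1,2) by (meson F_iff finite_UnI finite_subset)
      then have "card X < card Y" using \<open>X \<noteq> Y\<close> XY(3) by (meson psubsetI psubset_card_mono)
      then have X: "card X = c" "card (X \<inter> S) \<in> A" and Y: "card Y = c + 1" "card (Y \<inter> S) \<in> B"
        using XY(1,2) by (auto simp: F_iff)
      have "card (Y - X) = 1"
        using X Y XY(3) finY by (simp add: card_Diff_subset finite_subset)
      then obtain y where y: "Y - X = {y}" by (rule card_1_singletonE)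
      have "Y \<inter> S = (X \<inter> S) \<union> ((Y - X) \<inter> S)" using XY(3) by blast
      then have "card (Y \<inter> S) = card (X \<inter> S) + card ((Y - X) \<inter> S)"
        using finY XY(3) by (metis Diff_disjoint card_Un_disjoint finite_Diff finite_Int finite_subset inf_commute inf_left_commute inf_bot_right Int_assoc)
      moreover have "card ((Y - X) \<inter> S) \<le> 1" by (simp add: y card_insert_if Int_insert_left)
      ultimately have "card (Y \<inter> S) = card (X \<inter> S) \<or> card (Y \<inter> S) = Suc (card (X \<inter> S))" by linarith
      then show False using X Y AB(3,4) by (metis IntI empty_iff)
    qed
    have sym: "transpose u v ` E \<in> F" if "u \<in> S \<and> v \<in> S \<or> u \<in> T \<and> v \<in> T" "E \<in> F" for u v E
    proof -
      have "u \<in> S \<longleftrightarrow> v \<in> S" using that(1) ST(3) by auto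
      moreover have "transpose u v ` E \<subseteq> S \<union> T"
        using that by (intro transpose_image_subset) (auto simp: F_iff)
      ultimately show ?thesis
        using that(2) by (simp add: F_iff card_transpose_image_Int card_transpose_image)
    qed
    then show "transpose u v ` E \<in> F" if "u \<in> S" "v \<in> S" "E \<in> F" for u v E using that by blast
    show "transpose u v ` E \<in> F" if "u \<in> T" "v \<in> T" "E \<in> F" for u v E using sym that by blast
    show "(\<Sum>t<k. card (\<phi> (q, t) \<inter> T)) = card T" if "q < p" for q
    proof -
      have "card (\<phi> (q, t)) = card (\<phi> (q, t) \<inter> S) + card (\<phi> (q, t) \<inter> T)" if "t < k" for t
      proof -
        have "\<phi> (q, t) \<subseteq> S \<union> T" using mem[OF \<open>q < p\<close> that] by (simp add: F_iff)
        then have "\<phi> (q, t) = (\<phi> (q, t) \<inter> S) \<union> (\<phi> (q, t) \<inter> T)" by blast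
        then show ?thesis
          using ST(1-3) by (metis card_Un_disjoint finite_Int inf_assoc inf_bot_right inf_commute)
      qed
      then have "(\<Sum>t<k. card (\<phi> (q, t))) = (\<Sum>t<k. card (\<phi> (q, t) \<inter> S)) + (\<Sum>t<k. card (\<phi> (q, t) \<inter> T))"
        by (simp add: sum.distrib)
      then show ?thesis using tot[OF that] tot2[OF that] ST(5) by simp
    qed
  qed (use ST n mem tot \<phi>(1) in \<open>auto simp: F_iff case_prod_unfold\<close>)
  then show ?thesis using ST(6) by simp
qed

text \<open>If \<open>Mid\<close> types are used for one class size and \<open>Ext\<close> types for the other, with the parameters as in
  \<open>SP_ge_even_remainder\<close> and \<open>SP_ge_odd_remainder\<close>, then no \<open>c\<close>-set lies in a \<open>(c + 1)\<close>-set.\<close>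

definition Mid :: "nat \<Rightarrow> nat \<Rightarrow> nat set" where
  "Mid e l = {i. l \<le> i \<and> i + l \<le> e}"

definition Ext :: "nat \<Rightarrow> nat \<Rightarrow> nat set" where
  "Ext e l = {i. i \<le> e \<and> (i < l \<or> e < i + l)}"

lemma finite_Mid [simp]: "finite (Mid e l)"
  by (rule finite_subset[of _ "{..e}"]) (auto simp: Mid_def)

lemma finite_Ext [simp]: "finite (Ext e l)"
  by (rule finite_subset[of _ "{..e}"]) (auto simp: Ext_def)

text \<open>Slice the type counts into layers \<open>{i \<in> R. m < N i div s}\<close>. In a layer with bijections \<open>\<pi> t\<close>, the partition
  attached to \<open>y\<close> receives the types \<open>\<pi> 0 y, \<pi> 1 y, \<dots>\<close>, so every type of the layer is used exactly \<open>s\<close> times.\<close>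

lemma type_assignmentI_bijections:
  assumes "finite R" and p: "p \<le> (\<Sum>i\<in>R. N i div s)"
    and bij: "\<And>m. \<exists>\<pi>. \<forall>t<s. bij_betw (\<pi> t) {i \<in> R. m < N i div s} {i \<in> R. m < N i div s} \<and>
      (\<forall>y\<in>{i \<in> R. m < N i div s}. 2 * (\<Sum>t<s. \<pi> t y) = s * e)"
  shows "\<exists>\<tau>. type_assignment N s e R p \<tau>"
proof (cases "s = 0")
  case True
  then show ?thesis by (auto simp: type_assignment_def)
next
  case False
  let ?L = "\<lambda>m. {i \<in> R. m < N i div s}"
  define good where "good m \<pi> \<longleftrightarrow> (\<forall>t<s. bij_betw (\<pi> t) (?L m) (?L m) \<and>
    (\<forall>y\<in>?L m. 2 * (\<Sum>t<s. \<pi> t y) = s * e))" for m \<pi>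
  have "\<forall>m. \<exists>\<pi>. good m \<pi>"
    using bij by (simp only: good_def simp_thms)
  then obtain \<pi> where good: "\<And>m. good m (\<pi> m)"
    by metis
  have \<pi>: "bij_betw (\<pi> m t) (?L m) (?L m)" if "t < s" for m t
    using good[of m] that by (simp add: good_def)
  have sum_\<pi>: "2 * (\<Sum>t<s. \<pi> m t y) = s * e" if "y \<in> ?L m" for m y
    using good[of m] that False unfolding good_def by blast
  \<comment> \<open>One partition is available for each type \<open>i\<close> and layer
    \<open>m\<close>; type \<open>i\<close> lies in \<open>N i div s\<close> layers.\<close>
  let ?Y = "Sigma R (\<lambda>i. {..<N i div s})"
  have "card {..<p} \<le> card ?Y"
    using p assms(1) by (simp add: card_SigmaI)
  then obtain f where f: "f ` {..<p} \<subseteq> ?Y" "inj_on f {..<p}"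
    using card_le_inj[of "{..<p}" ?Y] assms(1) by auto
  define y m where "y q = fst (f q)" and "m q = snd (f q)" for q
  have ym: "y q \<in> ?L (m q)" if "q < p" for q
    using f(1) that by (force simp: y_def m_def)
  define \<tau> where "\<tau> q t = \<pi> (m q) t (y q)" for q t
  have mem: "\<tau> q t \<in> ?L (m q)" if "q < p" "t < s" for q t
    using bij_betwE[OF \<pi>[OF that(2)]] ym[OF that(1)] by (auto simp: \<tau>_def)
  have "card {(q, t). q < p \<and> t < s \<and> \<tau> q t = i} \<le> N i" for i
  proof -
    \<comment> \<open>In a given layer and place a type is taken by only one partition, because
      \<open>\<pi> m t\<close> is injective.\<close>
    have "inj_on (\<lambda>(q, t). (m q, t)) {(q, t). q < p \<and> t < s \<and> \<tau> q t = i}"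
    proof (rule inj_onI, clarsimp)
      fix q q' t assume h: "q < p" "q' < p" "t < s" "\<tau> q' t = \<tau> q t" "m q = m q'"
      then have "y q = y q'"
        using inj_onD[OF bij_betw_imp_inj_on[OF \<pi>[OF h(3), of "m q"]], of "y q" "y q'"] ym[of q] ym[of q']
        by (simp add: \<tau>_def)
      then have "f q = f q'" using h(5) by (simp add: y_def m_def prod_eq_iff)
      then show "q = q'" using f(2) h by (simp add: inj_on_def)
    qed
    then have "card {(q, t). q < p \<and> t < s \<and> \<tau> q t = i} \<le> card ({..<N i div s} \<times> {..<s})"
      using mem by (intro card_inj_on_le[of "\<lambda>(q, t). (m q, t)"]) auto
    also have "\<dots> \<le> N i" by simp
    finally show ?thesis .
  qed
  moreover have "2 * (\<Sum>t<s. \<tau> q t) = s * e" if "q < p" for q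
    using sum_\<pi>[OF ym[OF that]] by (simp add: \<tau>_def)
  ultimately have "type_assignment N s e R p \<tau>"
    using mem unfolding type_assignment_def by blast
  then show ?thesis by blast
qed

section \<open>Families of permutations with constant sum\<close>

definition reflection :: "nat \<Rightarrow> nat \<Rightarrow> nat \<Rightarrow> nat" where
  "reflection e t y = (if even t then y else e - y)"

lemma sum_reflection:
  assumes "y \<le> e"
  shows "(\<Sum>t<2 * u. reflection e t y) = u * e"
  using assms by (induction u) (simp_all add: reflection_def)

lemma bij_betw_reflection:
  assumes "\<And>y. y \<in> L \<Longrightarrow> y \<le> e \<and> e - y \<in> L"
  shows "bij_betw (reflection e t) L L"
proof (cases "even t")
  case True
  then show ?thesis by (simp add: reflection_def bij_betw_def inj_on_def)
next
  case False
  have "bij_betw (\<lambda>y. e - y) L L"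
    by (rule bij_betwI[of _ _ _ "\<lambda>y. e - y"]) (auto dest: assms)
  moreover have "reflection e t = (\<lambda>y. e - y)"
    using False by (simp add: reflection_def fun_eq_iff)
  ultimately show ?thesis by simp
qed

text \<open>Three permutations of \<open>{..2 * v}\<close> with constant sum. They are needed because an odd number of types
  cannot be balanced by pairs \<open>y\<close>, \<open>e - y\<close> alone.\<close>

definition triple_perm :: "nat \<Rightarrow> nat \<Rightarrow> nat \<Rightarrow> nat" where
  "triple_perm v t x = (if t = 0 then x
     else if t = 1 then (if even x then v - x div 2 else 2 * v - x div 2)
     else (if even x then 2 * v - x div 2 else v - x div 2 - 1))"

text \<open>For \<open>t = 1\<close> the even arguments fill \<open>{0..v}\<close> and the odd ones
  \<open>{v + 1..2 * v}\<close>; for \<open>t = 2\<close> the even ones fill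
  \<open>{v..2 * v}\<close> and the odd ones the rest.\<close>

lemma bij_betw_triple_perm: "bij_betw (triple_perm v t) {..2 * v} {..2 * v}"
proof -
  have "inj_on (triple_perm v t) {..2 * v}"
    by (rule inj_onI) (auto simp: triple_perm_def elim!: evenE oddE split: if_splits)
  moreover have "triple_perm v t ` {..2 * v} \<subseteq> {..2 * v}"
    by (auto simp: triple_perm_def)
  ultimately show ?thesis
    by (simp add: bij_betw_def endo_inj_surj)
qed

lemma sum_triple_perm:
  assumes "x \<le> 2 * v"
  shows "triple_perm v 0 x + triple_perm v 1 x + triple_perm v 2 x = 3 * v"
  using assms by (cases "even x") (auto simp: triple_perm_def elim!: evenE oddE)

lemma ex_zero_sum_bijections_even:
  fixes L :: "nat set"
  assumes "even s" "\<And>y. y \<in> L \<Longrightarrow> y \<le> e \<and> e - y \<in> L"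
  shows "\<exists>\<pi>. \<forall>t<s. bij_betw (\<pi> t) L L \<and> (\<forall>y\<in>L. 2 * (\<Sum>t<s. \<pi> t y) = s * e)"
proof -
  obtain u where "s = 2 * u" using assms(1) by blast
  then show ?thesis
    using bij_betw_reflection[of L e] sum_reflection[of _ e u] assms(2) by (intro exI[of _ "reflection e"]) auto
qed

text \<open>An odd \<open>s\<close> is three places served by \<open>triple_perm\<close>, followed
  by pairs of reflections. Transporting \<open>triple_perm\<close> needs an interval with an odd
  number of elements.\<close>

lemma ex_zero_sum_bijections_interval:
  fixes a v s :: nat
  assumes "v \<le> a" "s \<ge> 2"
  defines "L \<equiv> {a - v..a + v}"
  shows "\<exists>\<pi>. \<forall>t<s. bij_betw (\<pi> t) L L \<and> (\<forall>y\<in>L. 2 * (\<Sum>t<s. \<pi> t y) = s * (2 * a))"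
proof (cases "even s")
  case True
  then show ?thesis
    using assms by (intro ex_zero_sum_bijections_even) (auto simp: L_def)
next
  case False
  then obtain w where "s = 2 * w + 1" by (elim oddE)
  then have s: "s = 3 + 2 * (w - 1)" using assms(2) by auto
  define u where "u = w - 1"
  note s = s[folded u_def]
  define \<pi> where "\<pi> t y = (if t < 3 then a - v + triple_perm v t (y - (a - v)) else reflection (2 * a) (t - 3) y)" for t y
  have "bij_betw (\<pi> t) L L" for t
  proof (cases "t < 3")
    case True
    have "bij_betw (\<lambda>y. y - (a - v)) L {..2 * v}"
      using assms by (intro bij_betwI[of _ _ _ "\<lambda>x. a - v + x"]) auto
    moreover have "bij_betw (\<lambda>x. a - v + x) {..2 * v} L"
      using assms by (intro bij_betwI[of _ _ _ "\<lambda>y. y - (a - v)"]) auto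
    ultimately have "bij_betw ((\<lambda>x. a - v + x) \<circ> (triple_perm v t \<circ> (\<lambda>y. y - (a - v)))) L L"
      by (intro bij_betw_trans[OF bij_betw_trans[OF _ bij_betw_triple_perm]])
    moreover have "\<pi> t = (\<lambda>x. a - v + x) \<circ> (triple_perm v t \<circ> (\<lambda>y. y - (a - v)))"
      using True by (simp add: \<pi>_def fun_eq_iff)
    ultimately show ?thesis by simp
  next
    case False
    have "bij_betw (reflection (2 * a) (t - 3)) L L"
      by (rule bij_betw_reflection) (use assms(1) in \<open>auto simp: L_def\<close>)
    moreover have "\<pi> t = reflection (2 * a) (t - 3)"
      using False by (simp add: \<pi>_def fun_eq_iff)
    ultimately show ?thesis by simp
  qed
  moreover have "2 * (\<Sum>t<s. \<pi> t y) = s * (2 * a)" if "y \<in> L" for y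
  proof -
    have "(\<Sum>t<s. \<pi> t y) = (\<Sum>t<3. \<pi> t y) + (\<Sum>t<2 * u. reflection (2 * a) t y)"
      unfolding s sum_lessThan_add by (simp add: \<pi>_def)
    also have "(\<Sum>t<2 * u. reflection (2 * a) t y) = u * (2 * a)"
      using that by (intro sum_reflection) (use assms(1) in \<open>auto simp: L_def\<close>)
    also have "(\<Sum>t<3. \<pi> t y) = 3 * a"
    proof -
      define b x where "b = a - v" and "x = y - b"
      have "x \<le> 2 * v" "a = b + v"
        using that assms(1) by (auto simp: L_def b_def x_def)
      moreover have "(\<Sum>t<3. \<pi> t y) = 3 * b + (triple_perm v 0 x + triple_perm v 1 x + triple_perm v 2 x)"
        by (simp add: \<pi>_def flip: b_def x_def) (simp add: numeral_3_eq_3 numeral_2_eq_2)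
      ultimately show ?thesis
        by (simp only: sum_triple_perm) simp
    qed
    finally show ?thesis by (simp add: s algebra_simps)
  qed
  ultimately show ?thesis by blast
qed

text \<open>Rounding each \<open>N i\<close> down to a multiple of \<open>s\<close> loses less than
  \<open>s\<close>; this is the source of the terms \<open>s * (e + 1)\<close> below.\<close>

lemma sum_le_mult_sum_div:
  fixes N :: "nat \<Rightarrow> nat"
  assumes "finite R" "card R \<le> b" "p * s + s * b \<le> (\<Sum>i\<in>R. N i)" "s > 0"
  shows "p \<le> (\<Sum>i\<in>R. N i div s)"
proof -
  have "(\<Sum>i\<in>R. N i) \<le> (\<Sum>i\<in>R. s * (N i div s) + s)"
    using assms(4) by (intro sum_mono) (metis add_le_cancel_left less_imp_le mod_less_divisor mult_div_mod_eq)
  also have "\<dots> \<le> s * (\<Sum>i\<in>R. N i div s) + s * b"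
    using assms(2) by (simp add: sum.distrib sum_distrib_left mult.commute)
  finally have "p * s \<le> s * (\<Sum>i\<in>R. N i div s)"
    using assms(3) by linarith
  then show ?thesis
    using assms(4) by (metis mult.commute nat_mult_le_cancel1)
qed

lemma card_Mid_le: "card (Mid e l) \<le> e + 1"
  by (rule order_trans[OF card_mono[of "{..e}"]]) (auto simp: Mid_def)

lemma card_Ext_le: "card (Ext e l) \<le> e + 1"
  by (rule order_trans[OF card_mono[of "{..e}"]]) (auto simp: Ext_def)

lemma type_assignment_Ext:
  assumes sym: "\<And>i. i \<le> e \<Longrightarrow> N (e - i) = N i" and "even s"
    and "s = 0 \<or> p * s + s * (e + 1) \<le> (\<Sum>i\<in>Ext e l. N i)"
  shows "\<exists>\<tau>. type_assignment N s e (Ext e l) p \<tau>"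
proof (cases "s = 0")
  case True
  then show ?thesis by (auto simp: type_assignment_def)
next
  case False
  show ?thesis
  proof (rule type_assignmentI_bijections)
    show "p \<le> (\<Sum>i\<in>Ext e l. N i div s)"
      using assms(3) False card_Ext_le by (intro sum_le_mult_sum_div[of _ "e + 1"]) auto
  next
    fix m
    show "\<exists>\<pi>. \<forall>t<s. bij_betw (\<pi> t) {i \<in> Ext e l. m < N i div s} {i \<in> Ext e l. m < N i div s} \<and>
      (\<forall>y\<in>{i \<in> Ext e l. m < N i div s}. 2 * (\<Sum>t<s. \<pi> t y) = s * e)"
      using assms(2) by (rule ex_zero_sum_bijections_even) (auto simp: Ext_def sym)
  qed simp
qed

text \<open>Unimodality makes every layer an interval symmetric about \<open>e / 2\<close>; for odd
  \<open>s\<close> the evenness of \<open>e\<close> gives it an integer centre, as the three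
  permutations require. Layers of \<open>Ext\<close> types may have a gap in the middle, which
  leaves only complementary pairs there.\<close>

lemma type_assignment_Mid:
  assumes sym: "\<And>i. i \<le> e \<Longrightarrow> N (e - i) = N i"
    and unimodal: "\<And>i j. i \<le> j \<Longrightarrow> i + j \<le> e \<Longrightarrow> N i \<le> N j"
    and "even s \<or> even e" "s \<ge> 2"
    and "p * s + s * (e + 1) \<le> (\<Sum>i\<in>Mid e l. N i)"
  shows "\<exists>\<tau>. type_assignment N s e (Mid e l) p \<tau>"
proof (rule type_assignmentI_bijections)
  show "p \<le> (\<Sum>i\<in>Mid e l. N i div s)"
    using assms(4,5) card_Mid_le by (intro sum_le_mult_sum_div[of _ "e + 1"]) auto
next
  fix m
  let ?L = "{i \<in> Mid e l. m < N i div s}"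
  have symL: "y \<le> e \<and> e - y \<in> ?L" if "y \<in> ?L" for y
    using that by (auto simp: Mid_def sym)
  show "\<exists>\<pi>. \<forall>t<s. bij_betw (\<pi> t) ?L ?L \<and> (\<forall>y\<in>?L. 2 * (\<Sum>t<s. \<pi> t y) = s * e)"
  proof (cases "even s")
    case True
    then show ?thesis by (rule ex_zero_sum_bijections_even) (use symL in blast)
  next
    case odd: False
    then obtain a where e: "e = 2 * a" using assms(3) by blast
    show ?thesis
    proof (cases "?L = {}")
      case True
      show ?thesis unfolding True by (simp add: bij_betw_def)
    next
      case False
      define i where "i = Min ?L"
      have i: "i \<in> ?L" "\<And>j. j \<in> ?L \<Longrightarrow> i \<le> j"
        unfolding i_def using False by (intro Min_in Min_le; simp)+
      have "i \<le> a" using i(2)[of "e - i"] symL[OF i(1)] e by auto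
      have "?L = {i..e - i}"
      proof (intro equalityI subsetI)
        fix j assume "j \<in> ?L"
        then show "j \<in> {i..e - i}" using i(2)[of j] i(2)[of "e - j"] symL[of j] by auto
      next
        fix j assume j: "j \<in> {i..e - i}"
        then have "N i \<le> N j" using unimodal[of i j] symL[OF i(1)] by auto
        then have "N i div s \<le> N j div s" by (rule div_le_mono)
        then show "j \<in> ?L" using i(1) j by (auto simp: Mid_def)
      qed
      then have "?L = {a - (a - i)..a + (a - i)}" using \<open>i \<le> a\<close> e by auto
      then show ?thesis
        using ex_zero_sum_bijections_interval[of "a - i" a s] assms(4) e by simp
    qed
  qed
qed simp

section \<open>Symmetry and unimodality of the type counts\<close>

lemma split_count_sym: "i \<le> e \<Longrightarrow> split_count h e (e - i) = split_count h e i"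
  by (simp add: mult.commute)

lemma split_count_Suc:
  assumes "i < e" "e \<le> h"
  shows "split_count h e (Suc i) * (Suc i * (h - e + Suc i)) = split_count h e i * ((h - i) * (e - i))"
proof -
  have 1: "(h choose Suc i) * Suc i = (h choose i) * (h - i)"
    using Suc_mult_choose_Suc[of i h] by (simp only: mult.commute)
  have "(h choose Suc (e - Suc i)) * Suc (e - Suc i) = (h choose (e - Suc i)) * (h - (e - Suc i))"
    using Suc_mult_choose_Suc[of "e - Suc i" h] by (simp only: mult.commute)
  moreover have "Suc (e - Suc i) = e - i" "h - (e - Suc i) = h - e + Suc i"
    using assms by auto
  ultimately have 2: "(h choose (e - i)) * (e - i) = (h choose (e - Suc i)) * (h - e + Suc i)"
    by simp
  have "split_count h e (Suc i) * (Suc i * (h - e + Suc i))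
      = ((h choose Suc i) * Suc i) * ((h choose (e - Suc i)) * (h - e + Suc i))"
    by (simp only: mult_ac)
  also have "\<dots> = split_count h e i * ((h - i) * (e - i))"
    unfolding 1 2[symmetric] by (simp only: mult_ac)
  finally show ?thesis .
qed

lemma split_count_mono_step:
  assumes "2 * i + 1 \<le> e" "e \<le> h"
  shows "split_count h e i \<le> split_count h e (Suc i)"
proof -
  have "Suc i * (h - e + Suc i) \<le> (e - i) * (h - i)"
    using assms by (intro mult_mono) auto
  then have "split_count h e i * (Suc i * (h - e + Suc i)) \<le> split_count h e i * ((h - i) * (e - i))"
    by (intro mult_left_mono) (simp_all only: mult.commute le0)
  also have "\<dots> = split_count h e (Suc i) * (Suc i * (h - e + Suc i))"
    using split_count_Suc[of i e h] assms by simp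
  finally show ?thesis by (rule mult_right_le_imp_le) simp
qed

text \<open>The hypotheses say that \<open>j\<close> is at least as close to \<open>e / 2\<close> as
  \<open>i\<close>. A \<open>j\<close> beyond the middle is reflected to \<open>e - j\<close>, which
  is still at least \<open>i\<close>.\<close>

lemma split_count_unimodal:
  assumes "i \<le> j" "i + j \<le> e" "e \<le> h"
  shows "split_count h e i \<le> split_count h e j"
proof -
  have *: "split_count h e i \<le> split_count h e j" if "i \<le> j" "2 * j \<le> e + 1" for i j
    using that
  proof (induction j rule: dec_induct)
    case (step j)
    then show ?case using split_count_mono_step[of j e h] assms(3) by auto
  qed simp
  show ?thesis
  proof (cases "2 * j \<le> e")
    case True
    then show ?thesis using *[OF assms(1)] by simp
  next
    case False
    then have "split_count h e i \<le> split_count h e (e - j)"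
      using assms by (intro *) auto
    also have "\<dots> = split_count h e j"
      using assms by (intro split_count_sym) simp
    finally show ?thesis .
  qed
qed

text \<open>Here \<open>c * k\<close> is even, so an odd \<open>k - r\<close> forces
  \<open>c\<close> to be even, as the middle types need. The same \<open>l\<close> serves both
  sizes: adding a point to a set with type in \<open>Mid c l\<close> gives a type in
  \<open>Mid (c + 1) l\<close>.\<close>

lemma SP_ge_even_remainder:
  assumes n: "2 * h = c * k + r" "c > 0" "c + 1 \<le> h" "r + 2 \<le> k" "even r"
    and "p * (k - r) + (k - r) * (c + 1) \<le> (\<Sum>i\<in>Mid c l. split_count h c i)"
    and "r = 0 \<or> p * r + r * (c + 2) \<le> (\<Sum>i\<in>Ext (c + 1) l. split_count h (c + 1) i)"
  shows "p \<le> SP (2 * h) k"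
proof -
  have "even (c * k)" using n(1,5) by (metis dvd_triv_left even_add)
  then have "even (k - r) \<or> even c" using n(4,5) by auto
  then have "\<exists>\<alpha>. type_assignment (split_count h c) (k - r) c (Mid c l) p \<alpha>"
    using assms(6) n(3,4)
    by (intro type_assignment_Mid) (assumption | rule split_count_sym split_count_unimodal | simp)+
  moreover have "\<exists>\<beta>. type_assignment (split_count h (c + 1)) r (c + 1) (Ext (c + 1) l) p \<beta>"
    using assms(7) n(5)
    by (intro type_assignment_Ext) (assumption | rule split_count_sym | simp)+
  ultimately obtain \<alpha> \<beta> where \<alpha>: "type_assignment (split_count h c) (k - r) c (Mid c l) p \<alpha>"
    and \<beta>: "type_assignment (split_count h (c + 1)) r (c + 1) (Ext (c + 1) l) p \<beta>"
    by blast
  show ?thesis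
    by (rule SP_ge_if_type_assignments[OF n(1) _ n(2) \<alpha> \<beta>]) (use n(4) in \<open>auto simp: Mid_def Ext_def\<close>)
qed

text \<open>Now \<open>c * k\<close> is odd, so \<open>k - r\<close> and \<open>c + 1\<close> are
  even. The threshold \<open>l - 1\<close> leaves room for the added point: every
  \<open>(c + 1)\<close>-set above a set with type in \<open>Ext c (l - 1)\<close> has a type in
  \<open>Ext (c + 1) l\<close>.\<close>

lemma SP_ge_odd_remainder:
  assumes n: "2 * h = c * k + r" "c > 0" "c + 1 \<le> h" "r < k" "odd r" "r \<ge> 2"
    and "p * (k - r) + (k - r) * (c + 1) \<le> (\<Sum>i\<in>Ext c (l - 1). split_count h c i)"
    and "p * r + r * (c + 2) \<le> (\<Sum>i\<in>Mid (c + 1) l. split_count h (c + 1) i)"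
  shows "p \<le> SP (2 * h) k"
proof -
  have "odd (c * k)" using n(1,5) by (metis dvd_triv_left even_add)
  then have "even (k - r)" "even (c + 1)" using n(4,5) by auto
  then have "\<exists>\<alpha>. type_assignment (split_count h c) (k - r) c (Ext c (l - 1)) p \<alpha>"
    using assms(7)
    by (intro type_assignment_Ext) (assumption | rule split_count_sym | simp)+
  moreover have "\<exists>\<beta>. type_assignment (split_count h (c + 1)) r (c + 1) (Mid (c + 1) l) p \<beta>"
    using assms(8) n(3,6) \<open>even (c + 1)\<close>
    by (intro type_assignment_Mid) (assumption | rule split_count_sym split_count_unimodal | simp)+
  ultimately obtain \<alpha> \<beta> where \<alpha>: "type_assignment (split_count h c) (k - r) c (Ext c (l - 1)) p \<alpha>"
    and \<beta>: "type_assignment (split_count h (c + 1)) r (c + 1) (Mid (c + 1) l) p \<beta>"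
    by blast
  show ?thesis
    by (rule SP_ge_if_type_assignments[OF n(1,4,2) \<alpha> \<beta>]) (auto simp: Mid_def Ext_def)
qed

subsection \<open>Choosing the types\<close>

text \<open>Double counting of the pairs of an \<open>e\<close>-set of type \<open>j - 1\<close> or \<open>j\<close> inside an \<open>(e + 1)\<close>-set of type \<open>j\<close>.\<close>

lemma split_count_pascal:
  assumes "j \<le> Suc e"
  shows "Suc e * split_count h (Suc e) j
    = (case j of 0 \<Rightarrow> 0 | Suc i \<Rightarrow> (h - i) * split_count h e i)
      + (if j \<le> e then (h - (e - j)) * split_count h e j else 0)"
proof -
  have 1: "j * (h choose j) = (case j of 0 \<Rightarrow> 0 | Suc i \<Rightarrow> (h - i) * (h choose i))"
    using Suc_mult_choose_Suc by (simp split: nat.split)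
  have 2: "(Suc e - j) * (h choose (Suc e - j)) = (if j \<le> e then (h - (e - j)) * (h choose (e - j)) else 0)"
    using Suc_mult_choose_Suc[of "e - j" h] assms by (auto simp: Suc_diff_le)
  have "Suc e * split_count h (Suc e) j
      = j * (h choose j) * (h choose (Suc e - j)) + (h choose j) * ((Suc e - j) * (h choose (Suc e - j)))"
  proof -
    have "(j + d) * (X * Y) = j * X * Y + X * (d * Y)" for d X Y :: nat
      by (simp add: algebra_simps)
    from this[of "Suc e - j" "h choose j" "h choose (Suc e - j)"] show ?thesis
      using assms by (simp only: le_add_diff_inverse)
  qed
  then show ?thesis
    unfolding 1 2 by (simp split: nat.split)
qed

text \<open>The pairs are regrouped by the smaller set: an \<open>e\<close>-set of type
  \<open>i\<close> has \<open>h - i\<close> one-point extensions of type \<open>i + 1\<close> and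
  \<open>h - (e - i)\<close> of type \<open>i\<close>.\<close>

lemma sum_split_count_Suc:
  "(\<Sum>j\<le>Suc e. of_bool (j \<in> J) * (Suc e * split_count h (Suc e) j))
    = (\<Sum>i\<le>e. of_bool (Suc i \<in> J) * ((h - i) * split_count h e i)
        + of_bool (i \<in> J) * ((h - (e - i)) * split_count h e i))"
proof -
  have "(\<Sum>j\<le>Suc e. of_bool (j \<in> J) * (Suc e * split_count h (Suc e) j))
      = (\<Sum>j\<le>Suc e. of_bool (j \<in> J) * (case j of 0 \<Rightarrow> 0 | Suc i \<Rightarrow> (h - i) * split_count h e i))
        + (\<Sum>j\<le>Suc e. of_bool (j \<in> J) * (if j \<le> e then (h - (e - j)) * split_count h e j else 0))"
    unfolding sum.distrib[symmetric]
    by (rule sum.cong) (simp_all only: atMost_iff split_count_pascal add_mult_distrib2)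
  also have "(\<Sum>j\<le>Suc e. of_bool (j \<in> J) * (case j of 0 \<Rightarrow> 0 | Suc i \<Rightarrow> (h - i) * split_count h e i))
      = (\<Sum>i\<le>e. of_bool (Suc i \<in> J) * ((h - i) * split_count h e i))"
    by (subst sum.atMost_Suc_shift) (simp only: nat.case mult_0_right add_0)
  also have "(\<Sum>j\<le>Suc e. of_bool (j \<in> J) * (if j \<le> e then (h - (e - j)) * split_count h e j else 0))
      = (\<Sum>i\<le>e. of_bool (i \<in> J) * ((h - (e - i)) * split_count h e i))"
    by simp
  finally show ?thesis by (simp only: sum.distrib)
qed

definition ext_count :: "nat \<Rightarrow> nat \<Rightarrow> nat \<Rightarrow> nat" where
  "ext_count h e l = (\<Sum>i\<in>Ext e l. split_count h e i)"

lemma ext_count_eq: "ext_count h e l = (\<Sum>i\<le>e. of_bool (i \<in> Ext e l) * split_count h e i)"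
  unfolding ext_count_def
  by (rule sum.mono_neutral_cong_left) (auto simp: Ext_def)

lemma Suc_mult_ext_count:
  "Suc e * ext_count h (Suc e) l = (\<Sum>i\<le>e. of_bool (Suc i \<in> Ext (Suc e) l) * ((h - i) * split_count h e i)
        + of_bool (i \<in> Ext (Suc e) l) * ((h - (e - i)) * split_count h e i))"
  unfolding sum_split_count_Suc[symmetric] ext_count_eq sum_distrib_left
  by (intro sum.cong) (simp_all only: mult_ac)

lemma mult_ext_count:
  assumes "e \<le> h"
  shows "(2 * h - e) * ext_count h e l = (\<Sum>i\<le>e. of_bool (i \<in> Ext e l) * ((h - i) * split_count h e i)
        + of_bool (i \<in> Ext e l) * ((h - (e - i)) * split_count h e i))"
  unfolding ext_count_eq sum_distrib_left
proof (rule sum.cong)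
  fix i assume "i \<in> {..e}"
  then have "2 * h - e = (h - i) + (h - (e - i))" using assms by auto
  moreover have alg: "(a + b) * (t * x) = t * (a * x) + t * (b * x)" for a b t x :: nat
    by (simp add: algebra_simps)
  ultimately have "(2 * h - e) * (of_bool (i \<in> Ext e l) * split_count h e i)
      = ((h - i) + (h - (e - i))) * (of_bool (i \<in> Ext e l) * split_count h e i)" by (simp only:)
  then show "(2 * h - e) * (of_bool (i \<in> Ext e l) * split_count h e i)
      = of_bool (i \<in> Ext e l) * ((h - i) * split_count h e i) + of_bool (i \<in> Ext e l) * ((h - (e - i)) * split_count h e i)"
    by (simp only: alg)
qed simp

text \<open>Every \<open>e\<close>-subset of a set with type in \<open>Ext (Suc e) l\<close> has a
  type in \<open>Ext e l\<close>.\<close>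

lemma ext_count_Suc_le:
  assumes "e \<le> h"
  shows "Suc e * ext_count h (Suc e) l \<le> (2 * h - e) * ext_count h e l"
  unfolding Suc_mult_ext_count mult_ext_count[OF assms]
  by (intro sum_mono add_mono mult_right_mono) (auto simp: Ext_def)

text \<open>Every one-point extension of a set with type in \<open>Ext e (l - 1)\<close> has a type
  in \<open>Ext (Suc e) l\<close>. Hence the proportions of extreme types on consecutive levels
  agree up to a shift of \<open>l\<close> by one.\<close>

lemma ext_count_le_Suc:
  assumes "e \<le> h"
  shows "(2 * h - e) * ext_count h e (l - 1) \<le> Suc e * ext_count h (Suc e) l"
  unfolding Suc_mult_ext_count mult_ext_count[OF assms]
  by (intro sum_mono add_mono mult_right_mono) (auto simp: Ext_def)

lemma ext_count_step:
  assumes "\<And>i. i \<le> e \<Longrightarrow> split_count h e i \<le> g"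
  shows "ext_count h e (Suc l) \<le> ext_count h e l + 2 * g"
proof -
  have "ext_count h e (Suc l) \<le> (\<Sum>i\<in>Ext e l \<union> ({l, e - l} \<inter> {..e}). split_count h e i)"
    unfolding ext_count_def by (rule sum_mono2) (auto simp: Ext_def)
  also have "\<dots> \<le> ext_count h e l + (\<Sum>i\<in>{l, e - l} \<inter> {..e}. split_count h e i)"
    unfolding ext_count_def by (simp add: sum_Un_nat)
  also have "(\<Sum>i\<in>{l, e - l} \<inter> {..e}. split_count h e i) \<le> (\<Sum>i\<in>{l, e - l} \<inter> {..e}. g)"
    using assms by (intro sum_mono) auto
  also have "\<dots> \<le> 2 * g"
    using card_mono[of "{l, e - l}" "{l, e - l} \<inter> {..e}"] card_insert_le_m1[of 2 "{e - l}" l]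
    by (auto intro!: mult_right_mono)
  finally show ?thesis by simp
qed

text \<open>One step pays for the overshoot of a threshold chosen as least, the other for the shift
  between the levels; each admits at most two new types.\<close>

lemma ext_count_two_steps:
  assumes "\<And>i. i \<le> e \<Longrightarrow> split_count h e i \<le> g"
  shows "ext_count h e l \<le> ext_count h e (l - 2) + 4 * g"
proof -
  consider "l = 0" | "l = 1" | l' where "l = Suc (Suc l')"
    by (metis One_nat_def not0_implies_Suc)
  then show ?thesis
  proof cases
    case 2
    then show ?thesis using ext_count_step[of e h g 0] assms by simp
  next
    case 3
    then show ?thesis
      using ext_count_step[of e h g l'] ext_count_step[of e h g "Suc l'"] assms by simp
  qed simp
qed

lemma sum_split_count: "(\<Sum>i\<le>e. split_count h e i) = (2 * h choose e)"
  using vandermonde[of h h e] by (simp add: mult_2)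

lemma sum_Mid_plus_ext_count:
  "(\<Sum>i\<in>Mid e l. split_count h e i) + ext_count h e l = (2 * h choose e)"
proof -
  have "{..e} = Mid e l \<union> Ext e l" "Mid e l \<inter> Ext e l = {}"
    by (auto simp: Mid_def Ext_def)
  then show ?thesis
    using sum.union_disjoint[of "Mid e l" "Ext e l" "split_count h e"]
    by (simp add: ext_count_def flip: sum_split_count)
qed

lemma ext_count_0 [simp]: "ext_count h e 0 = 0"
  by (auto simp: ext_count_def Ext_def intro!: sum.neutral)

lemma ext_count_top: "e < l \<Longrightarrow> ext_count h e l = (2 * h choose e)"
  unfolding sum_split_count[symmetric] ext_count_def by (rule sum.cong) (auto simp: Ext_def)

text \<open>The \<open>(c + 1)\<close>-sets receive just enough types, so that only about \<open>4 * g\<close> more \<open>c\<close>-sets than necessary are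
  lost to their shadow. An odd number of classes of one size must come from \<open>Mid\<close> types of an even size:
  for even \<open>r\<close> the \<open>c\<close>-sets are in the middle, and for odd \<open>r\<close> (where \<open>c\<close> and \<open>k\<close> are odd) the \<open>(c + 1)\<close>-sets.\<close>

lemma SP_ge_even:
  assumes n: "2 * h = c * k + r" "r < k" "3 \<le> k" "2 \<le> c" "r \<noteq> 1" "r \<noteq> k - 1"
    and g: "\<And>i. i \<le> c \<Longrightarrow> split_count h c i \<le> g"
    and p: "real p * (real k - real r + real r * (real c + 1) / (real (2 * h) - real c))
      + 4 * real g + 8 * real (2 * h) \<le> real (2 * h choose c)"
  shows "p \<le> SP (2 * h) k"
proof -
  have ck: "c * 3 \<le> c * k" using n(3) by simp
  then have h: "c + 1 \<le> h" using n(1,4) by linarith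
  \<comment> \<open>\<open>\<rho>\<close> is the size of level \<open>c\<close> divided by that of
    level \<open>c + 1\<close>, so it converts a number of \<open>(c + 1)\<close>-sets into the
    equivalent number of \<open>c\<close>-sets.\<close>
  define \<rho> where "\<rho> = (real c + 1) / (real (2 * h) - real c)"
  define A where "A = (k - r) * (c + 1)"
  define B where "B = r * (c + 2)"
  have den: "real c + 1 \<le> real (2 * h) - real c" using h by linarith
  then have \<rho>: "0 \<le> \<rho>" "\<rho> \<le> 1" by (auto simp: \<rho>_def)
  have k_le: "k \<le> c * k" using n(4) by simp
  have "A \<le> k * (c + 1)" "B \<le> k * (c + 2)"
    unfolding A_def B_def using n(2) by (intro mult_right_mono; simp)+
  moreover have "k * (c + 1) = c * k + k" "k * (c + 2) = c * k + 2 * k"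
    by simp_all
  \<comment> \<open>\<open>A\<close> and \<open>B\<close> are the rounding losses of the two type
    assignments; as \<open>\<rho> \<le> 1\<close>, they fit into the term
    \<open>8 * real (2 * h)\<close>.\<close>
  ultimately have AB: "A \<le> 2 * (2 * h)" "B \<le> 3 * (2 * h)"
    using n(1) k_le by linarith+
  have "real (Suc c) * real (2 * h choose Suc c) = real (2 * h - c) * real (2 * h choose c)"
    using Suc_mult_choose_Suc[of c "2 * h"] by (metis of_nat_mult)
  then have C: "\<rho> * real (2 * h choose Suc c) = real (2 * h choose c)"
    using h den by (simp add: \<rho>_def of_nat_diff field_simps)
  define w where "w = p * r + B"
  have w: "real p * real (k - r) + real A + \<rho> * real w + 4 * real g \<le> real (2 * h choose c)"
  proof -
    have "\<rho> * real B \<le> real B" using \<rho> mult_left_le_one_le[of "real B" \<rho>] by simp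
    moreover have "real A \<le> 2 * real (2 * h)" "real B \<le> 3 * real (2 * h)"
      using AB by linarith+
    moreover have "real p * (real k - real r + real r * (real c + 1) / (real (2 * h) - real c))
        = real p * real (k - r) + \<rho> * (real p * real r)"
      using n(2) by (simp add: \<rho>_def of_nat_diff algebra_simps)
    moreover have "\<rho> * real w = \<rho> * (real p * real r) + \<rho> * real B"
      by (simp add: w_def algebra_simps)
    ultimately show ?thesis using p by linarith
  qed
  have w_le: "w \<le> (2 * h choose Suc c)"
  proof -
    have "\<rho> * real w \<le> \<rho> * real (2 * h choose Suc c)"
      using w unfolding C by (smt (verit) of_nat_0_le_iff mult_nonneg_nonneg)
    moreover have "\<rho> > 0" using den by (simp add: \<rho>_def)
    ultimately show ?thesis by simp
  qed
  have e1: "real (ext_count h (Suc c) l) * \<rho> \<le> real (ext_count h c l)" for l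
  proof -
    have "real (Suc c) * real (ext_count h (Suc c) l) \<le> real (2 * h - c) * real (ext_count h c l)"
      using ext_count_Suc_le[of c h l] h by (metis add_leD1 of_nat_le_iff of_nat_mult)
    then show ?thesis using h den by (simp add: \<rho>_def of_nat_diff field_simps)
  qed
  have e2: "real (ext_count h c (l - 1)) \<le> real (ext_count h (Suc c) l) * \<rho>" for l
  proof -
    have "real (2 * h - c) * real (ext_count h c (l - 1)) \<le> real (Suc c) * real (ext_count h (Suc c) l)"
      using ext_count_le_Suc[of c h l] h by (metis add_leD1 of_nat_le_iff of_nat_mult)
    then show ?thesis using h den by (simp add: \<rho>_def of_nat_diff field_simps)
  qed
  have e3: "real (ext_count h c l) \<le> real (ext_count h c (l - 2)) + 4 * real g" for l
    using ext_count_two_steps[of c h g l] g by (metis (mono_tags) of_nat_add of_nat_le_iff of_nat_mult of_nat_numeral)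
  have mid: "real (\<Sum>i\<in>Mid e l. split_count h e i) = real (2 * h choose e) - real (ext_count h e l)" for e l
    using arg_cong[OF sum_Mid_plus_ext_count[of h e l], of real] by simp
  show ?thesis
  proof (cases "even r")
    case True
    show ?thesis
    proof (cases "r = 0")
      case r0: True
      have "real (p * (k - r) + A) \<le> real (\<Sum>i\<in>Mid c 0. split_count h c i)"
        using w \<rho>(1) unfolding mid by (simp add: mult_nonneg_nonneg) (smt (verit) of_nat_0_le_iff mult_nonneg_nonneg)
      then show ?thesis
        using n h r0 unfolding A_def of_nat_le_iff by (intro SP_ge_even_remainder[of h c k r p 0]) auto
    next
      case r0: False
      define l where "l = (LEAST l. w \<le> ext_count h (Suc c) l)"
      have "w \<le> ext_count h (Suc c) (c + 2)"
        using w_le by (simp add: ext_count_top)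
      then have l: "w \<le> ext_count h (Suc c) l"
        unfolding l_def by (rule LeastI)
      have "w > 0" using r0 by (simp add: w_def B_def)
      then have "l \<noteq> 0" using l by (metis ext_count_0 not_le)
      then have "ext_count h (Suc c) (l - 1) < w"
        using not_less_Least[of "l - 1" "\<lambda>l. w \<le> ext_count h (Suc c) l"] by (simp add: l_def)
      \<comment> \<open>Minimality bounds the extreme types of level \<open>c + 1\<close> at
        \<open>l - 1\<close>; \<open>e2\<close> carries this to level \<open>c\<close> at
        \<open>l - 2\<close>, and \<open>e3\<close> returns to \<open>l\<close> at a cost of
        \<open>4 * g\<close>.\<close>
      then have "real (ext_count h (Suc c) (l - 1)) * \<rho> \<le> \<rho> * real w"
        using \<rho>(1) by (simp add: mult.commute mult_left_mono)
      then have "real (ext_count h c l) \<le> \<rho> * real w + 4 * real g"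
        using e3[of l] e2[of "l - 1", unfolded diff_diff_left one_add_one] by linarith
      then have "real (p * (k - r) + A) \<le> real (\<Sum>i\<in>Mid c l. split_count h c i)"
        using w unfolding mid by simp
      then show ?thesis
        using n h l \<open>even r\<close> unfolding of_nat_le_iff w_def B_def A_def ext_count_def
        by (intro SP_ge_even_remainder[of h c k r p l]) auto
    qed
  next
    case False
    \<comment> \<open>The roles are exchanged: \<open>l\<close> is the first threshold at which the
      middle types no longer supply \<open>w\<close> sets, so they use \<open>l - 1\<close>, and the
      extreme \<open>c\<close>-sets use \<open>l - 2\<close>.\<close>
    define l where "l = (LEAST l. (\<Sum>i\<in>Mid (Suc c) l. split_count h (Suc c) i) < w)"
    have "w > 0" using False by (cases r) (simp_all add: w_def B_def)
    then have "(\<Sum>i\<in>Mid (Suc c) (c + 2). split_count h (Suc c) i) < w"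
      by (simp add: Mid_def)
    then have l: "(\<Sum>i\<in>Mid (Suc c) l. split_count h (Suc c) i) < w"
      unfolding l_def by (rule LeastI)
    have "w \<le> (\<Sum>i\<in>Mid (Suc c) 0. split_count h (Suc c) i)"
      using w_le sum_Mid_plus_ext_count[of h "Suc c" 0] by simp
    then have "l \<noteq> 0" using l by (metis not_le)
    then have l': "w \<le> (\<Sum>i\<in>Mid (Suc c) (l - 1). split_count h (Suc c) i)"
      using not_less_Least[of "l - 1" "\<lambda>l. (\<Sum>i\<in>Mid (Suc c) l. split_count h (Suc c) i) < w"]
      by (simp add: l_def)
    have "real (2 * h choose Suc c) - real (ext_count h (Suc c) l) \<le> real w"
      using l mid[of "Suc c" l] by linarith
    then have "\<rho> * (real (2 * h choose Suc c) - real (ext_count h (Suc c) l)) \<le> \<rho> * real w"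
      using \<rho>(1) by (rule mult_left_mono)
    then have "real (2 * h choose c) - real (ext_count h (Suc c) l) * \<rho> \<le> \<rho> * real w"
      using C by (simp add: algebra_simps)
    then have "real (p * (k - r) + A) \<le> real (ext_count h c (l - 2))"
      using w e3[of l] e1[of l] by simp
    moreover have "l - 2 = l - 1 - 1" by simp
    moreover have "r \<ge> 2" using False n(5) by (cases r) auto
    ultimately show ?thesis
      using n h l' False unfolding of_nat_le_iff w_def B_def A_def ext_count_def
      by (intro SP_ge_odd_remainder[of h c k r p "l - 1"]) auto
  qed
qed

text \<open>Near the middle the type counts are almost constant, hence no single type carries a positive
  proportion of all \<open>c\<close>-sets.\<close>

lemma mult_split_count_near_middle:
  assumes "c \<le> h" "j < J" "J \<le> m" "m = c div 2"
  shows "(1 - 4 * real J / real m) * real (split_count h c (m - j)) \<le> real (split_count h c (m - Suc j))"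
proof -
  define i where "i = m - Suc j"
  \<comment> \<open>The ratio of neighbouring counts is at least
    \<open>(m - j) / (m + j + 2)\<close> times the same with \<open>u\<close> for \<open>m\<close>;
    the \<open>2\<close> covers the step to \<open>Suc j\<close> and an odd
    \<open>c\<close>.\<close>
  define u where "u = h - c + m"
  have i: "Suc i = m - j" "i < c" and mu: "m \<le> u" "m > 0" using assms by (auto simp: i_def u_def)
  have "split_count h c (m - j) * ((m - j) * (u - j)) = split_count h c i * ((h - i) * (c - i))"
  proof -
    have "h - c + Suc i = u - j" using assms by (auto simp: i_def u_def)
    then show ?thesis using split_count_Suc[OF i(2) assms(1)] unfolding i(1) by simp
  qed
  also have "\<dots> \<le> split_count h c i * ((u + j + 2) * (m + j + 2))"
    using assms by (intro mult_left_mono mult_mono) (auto simp: i_def u_def)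
  finally have "real (split_count h c (m - j) * ((m - j) * (u - j)))
      \<le> real (split_count h c i * ((u + j + 2) * (m + j + 2)))"
    by (simp only: of_nat_le_iff)
  moreover have "j \<le> m" "j \<le> u" using assms mu by auto
  ultimately have "real (split_count h c (m - j)) * ((real m - real j) * (real u - real j))
      \<le> real (split_count h c i) * ((real u + real j + 2) * (real m + real j + 2))" (is "?a * _ \<le> ?b * _")
    by (simp only: of_nat_mult of_nat_diff of_nat_add of_nat_numeral)
  then have le: "?a * (((real m - real j) / (real m + real j + 2)) * ((real u - real j) / (real u + real j + 2))) \<le> ?b"
    by (simp add: divide_simps mult_ac)
  have ratio: "1 - 2 * real J / real m \<le> (real x - real j) / (real x + real j + 2)" if "m \<le> x" for x
  proof -
    have "2 * real j + 2 \<le> 2 * real J" using assms(2) by linarith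
    then have "(2 * real j + 2) / (real x + real j + 2) \<le> 2 * real J / real m"
      using mu(2) that by (intro frac_le) auto
    moreover have "(real x - real j) / (real x + real j + 2) = 1 - (2 * real j + 2) / (real x + real j + 2)"
      by (simp add: field_simps)
    ultimately show ?thesis by linarith
  qed
  show ?thesis
  proof (cases "2 * J \<le> m")
    case False
    then have "1 - 4 * real J / real m \<le> 0" using mu(2) by (simp add: field_simps)
    then show ?thesis
      by (meson mult_nonpos_nonneg of_nat_0_le_iff order_trans)
  next
    case True
    define t where "t = 2 * real J / real m"
    have t: "0 \<le> 1 - t" using True mu(2) by (simp add: t_def field_simps)
    have "1 - 4 * real J / real m \<le> (1 - t) * (1 - t)"
      by (simp add: t_def algebra_simps power2_eq_square)
    also have "\<dots> \<le> ((real m - real j) / (real m + real j + 2)) * ((real u - real j) / (real u + real j + 2))"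
      using ratio[of m] ratio[of u] mu(1) t by (intro mult_mono) (auto simp: t_def)
    finally show ?thesis
      using le by (smt (verit) i_def mult.commute mult_left_mono of_nat_0_le_iff)
  qed
qed

text \<open>Bernoulli's inequality for \<open>j\<close> steps that each keep a proportion of at
  least \<open>1 - 4 * J / m\<close>; where this is negative, the bound after a step is
  trivial.\<close>

lemma split_count_near_middle:
  assumes "c \<le> h" "j \<le> J" "J \<le> m" "m = c div 2"
  shows "(1 - real j * (4 * real J / real m)) * real (split_count h c m) \<le> real (split_count h c (m - j))"
  using assms(2)
proof (induction j)
  case (Suc j)
  define t where "t = 4 * real J / real m"
  define M where "M = real (split_count h c m)"
  have M: "M \<ge> 0" and t: "t \<ge> 0" by (simp_all add: M_def t_def)
  show ?case
  proof (cases "t \<le> 1")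
    case True
    have "(1 - real (Suc j) * t) * M \<le> (1 - t) * ((1 - real j * t) * M)"
      using M t by (simp add: algebra_simps mult_nonneg_nonneg)
    also have "\<dots> \<le> (1 - t) * real (split_count h c (m - j))"
      using Suc True by (intro mult_left_mono) (auto simp: t_def M_def)
    also have "\<dots> \<le> real (split_count h c (m - Suc j))"
      using mult_split_count_near_middle[of c h j J m] assms Suc.prems by (simp add: t_def)
    finally show ?thesis by (simp only: t_def M_def)
  next
    case False
    then have "1 \<le> real (Suc j) * t"
      using t by (simp add: algebra_simps) (smt (verit) mult_nonneg_nonneg of_nat_0_le_iff)
    then have "(1 - real (Suc j) * t) * M \<le> 0"
      using M by (simp add: mult_nonpos_nonneg)
    then show ?thesis unfolding t_def M_def by (meson of_nat_0_le_iff order_trans)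
  qed
qed simp

text \<open>The factor \<open>8\<close> makes each of the \<open>J + 1\<close> counts from
  \<open>c div 2 - J\<close> to \<open>c div 2\<close> at least half of the largest, and together
  they count at most all \<open>c\<close>-sets.\<close>

lemma split_count_le_fraction:
  assumes "c \<le> h" "8 * J\<^sup>2 \<le> c div 2" "i \<le> c"
  shows "real (J + 1) * real (split_count h c i) \<le> 2 * real (2 * h choose c)"
proof -
  define m where "m = c div 2"
  define M where "M = real (split_count h c m)"
  have Jm: "J \<le> m" using assms(2) unfolding m_def by (smt (verit) le_trans power2_nat_le_imp_le le_square power2_eq_square mult_le_mono1 nat_mult_1 one_le_numeral)
  have iM: "real (split_count h c i) \<le> M"
  proof (cases "i \<le> m")
    case True
    then have "split_count h c i \<le> split_count h c m"
      using assms(1) by (intro split_count_unimodal) (auto simp: m_def)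
    then show ?thesis
      unfolding M_def of_nat_le_iff .
  next
    case False
    then have "split_count h c (c - i) \<le> split_count h c m"
      using assms(1,3) by (intro split_count_unimodal) (auto simp: m_def)
    then show ?thesis
      unfolding M_def of_nat_le_iff split_count_sym[OF assms(3)] .
  qed
  have half: "M / 2 \<le> real (split_count h c (m - j))" if "j \<le> J" for j
  proof -
    have "real j * (4 * real J / real m) \<le> 1 / 2"
    proof (cases "m = 0")
      case False
      have "real j * real J \<le> real J * real J" using that by (intro mult_right_mono) auto
      moreover have "8 * (real J * real J) \<le> real m"
        using assms(2) unfolding m_def power2_eq_square by (metis of_nat_le_iff of_nat_mult of_nat_numeral)
      ultimately have "8 * (real j * real J) \<le> real m" by linarith
      then show ?thesis using False by (simp add: divide_simps mult_ac)
    qed simp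
    then have "1 / 2 * M \<le> (1 - real j * (4 * real J / real m)) * M"
      by (intro mult_right_mono) (auto simp: M_def)
    also have "\<dots> \<le> real (split_count h c (m - j))"
      unfolding M_def using split_count_near_middle[of c h j J m] assms(1) that Jm m_def by simp
    finally show ?thesis by simp
  qed
  have "real (J + 1) * (M / 2) = (\<Sum>j\<le>J. M / 2)" by simp
  also have "\<dots> \<le> (\<Sum>j\<le>J. real (split_count h c (m - j)))"
    using half by (intro sum_mono) simp
  also have "\<dots> = real (\<Sum>i\<in>(\<lambda>j. m - j) ` {..J}. split_count h c i)"
    using Jm by (subst sum.reindex) (auto intro!: inj_onI)
  also have "\<dots> \<le> real (\<Sum>i\<le>c. split_count h c i)"
    unfolding of_nat_le_iff by (rule sum_mono2) (auto simp: m_def)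
  finally have "real (J + 1) * M \<le> 2 * real (2 * h choose c)"
    unfolding sum_split_count by simp
  moreover have "real (J + 1) * real (split_count h c i) \<le> real (J + 1) * M"
    using iM by (intro mult_left_mono) auto
  ultimately show ?thesis by linarith
qed

subsection \<open>Asymptotics\<close>

text \<open>The denominator of \<open>MMS\<close>.\<close>

definition weight :: "nat \<Rightarrow> nat \<Rightarrow> nat \<Rightarrow> nat \<Rightarrow> real" where
  "weight n k c r = real k - real r + real r * (real c + 1) / (real n - real c)"

lemma MMS_eq:
  assumes "n = c * k + r" "r < k"
  shows "MMS n k = real (n choose c) / weight n k c r"
proof -
  have "n div k = c" "n mod k = r" using assms by auto
  then show ?thesis by (simp add: MMS_def weight_def)
qed

text \<open>The fraction is at most \<open>2\<close> because
  \<open>r * (c + 1) \<le> (k - 1) * (2 * c) \<le> 2 * (n - c)\<close>. So the weight is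
  \<open>k - r\<close> up to a bounded error, negligible when \<open>k - r\<close> is large.\<close>

lemma weight_bounds:
  assumes "n = c * k + r" "r < k" "3 \<le> k" "2 \<le> c"
  shows "real (k - r) \<le> weight n k c r" "weight n k c r \<le> real (k - r) + 2" "0 < weight n k c r"
proof -
  have ck: "c * 3 \<le> c * k" using assms(3) by simp
  have den: "real n - real c > 0" using assms(1,4) ck by linarith
  have "r * (c + 1) \<le> (k - 1) * (2 * c)" using assms(2,4) by (intro mult_mono) auto
  also have "\<dots> = 2 * (c * k - c)" by (simp add: diff_mult_distrib2 algebra_simps)
  also have "\<dots> \<le> 2 * (n - c)" using assms(1) by simp
  finally have "real (r * (c + 1)) \<le> real (2 * (n - c))" by (simp only: of_nat_le_iff)
  then have "real r * (real c + 1) \<le> 2 * (real n - real c)"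
    using den by (simp add: of_nat_diff algebra_simps)
  then have "real r * (real c + 1) / (real n - real c) \<le> 2"
    using den by (simp add: divide_simps)
  moreover have "0 \<le> real r * (real c + 1) / (real n - real c)" using den by simp
  moreover have "real (k - r) = real k - real r" using assms(2) by (simp add: of_nat_diff)
  moreover have "real k - real r > 0" using assms(2) by simp
  ultimately show "real (k - r) \<le> weight n k c r" "weight n k c r \<le> real (k - r) + 2" "0 < weight n k c r"
    unfolding weight_def by linarith+
qed

lemma SP_mult_weight_le:
  assumes "n = c * k + r" "r < k" "3 \<le> k" "2 \<le> c"
  shows "real (SP n k) * weight n k c r \<le> real (n choose c)"
proof -
  have ck: "c * 3 \<le> c * k" using assms(3) by simp
  obtain C :: "nat set set set" where "sperner_partition_system n k C" "card C = SP n k"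
    using SP_attained by blast
  then show ?thesis
    using sperner_partition_system_card_le_MMS[of n k C c r] assms ck unfolding weight_def by simp
qed

text \<open>Level \<open>c\<close> is below the middle, hence at least as large as level
  \<open>2\<close>, which is quadratic in \<open>n\<close>. This absorbs the errors linear in
  \<open>n\<close>.\<close>

lemma linear_le_binomial:
  assumes "2 \<le> c" "3 * c \<le> n" "2 * x + 1 \<le> real n"
  shows "x * real n \<le> real (n choose c)"
proof -
  have "n choose 2 \<le> n choose c"
    using assms by (intro binomial_mono) auto
  then have "real (n choose 2) \<le> real (n choose c)" by simp
  moreover have "real (n choose 2) = real n * (real n - 1) / 2"
    using assms by (simp add: choose_two real_of_nat_div of_nat_diff)
  moreover have "real n * (2 * x) \<le> real n * (real n - 1)"
    using assms(3) by (intro mult_left_mono) auto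
  then have "2 * (x * real n) \<le> real n * (real n - 1)"
    by (simp only: mult_ac)
  ultimately show ?thesis by simp
qed

lemma SP_mult_weight_ge_even:
  assumes "\<epsilon> > 0"
  shows "\<exists>c\<^sub>0\<ge>2. \<forall>n k c r. n = c * k + r \<longrightarrow> r < k \<longrightarrow> 3 \<le> k \<longrightarrow> c\<^sub>0 \<le> c \<longrightarrow> even n \<longrightarrow> r \<noteq> 1 \<longrightarrow> r \<noteq> k - 1 \<longrightarrow>
    (1 - \<epsilon>) * real (n choose c) \<le> real (SP n k) * weight n k c r"
proof -
  \<comment> \<open>\<open>J\<close> makes \<open>4 * g\<close> at most
    \<open>\<epsilon> / 2\<close> of all \<open>c\<close>-sets, and \<open>c1\<close> does the same
    for \<open>10 * n\<close>: \<open>8 * n\<close> comes from \<open>SP_ge_even\<close>, and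
    \<open>2 * n\<close> bounds the weight lost by rounding the number of partitions down.\<close>
  obtain J :: nat where J: "16 / \<epsilon> < real J" using reals_Archimedean2 by blast
  obtain c1 :: nat where c1: "40 / \<epsilon> + 1 < real c1" using reals_Archimedean2 by blast
  define c0 where "c0 = 16 * J\<^sup>2 + c1 + 2"
  have "(1 - \<epsilon>) * real (n choose c) \<le> real (SP n k) * weight n k c r"
    if n: "n = c * k + r" "r < k" "3 \<le> k" "c0 \<le> c" "even n" "r \<noteq> 1" "r \<noteq> k - 1" for n k c r
  proof -
    obtain h where h: "n = 2 * h" using n(5) by blast
    have ck: "c * 3 \<le> c * k" using n(3) by simp
    have c2: "2 \<le> c" "c1 \<le> c" "16 * J\<^sup>2 \<le> c" using n(4) by (auto simp: c0_def)
    have ch: "c \<le> h" using n(1) h ck by linarith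
    define C where "C = real (n choose c)"
    define g where "g = nat \<lfloor>2 * C / real (J + 1)\<rfloor>"
    have g: "split_count h c i \<le> g" if "i \<le> c" for i
    proof -
      have "real (split_count h c i) \<le> 2 * C / real (J + 1)"
        using split_count_le_fraction[OF ch _ that, of J] c2(3) h by (simp add: C_def field_simps)
      then show ?thesis unfolding g_def by (simp add: le_nat_floor)
    qed
    have "C \<ge> 0" by (simp add: C_def)
    then have "real g \<le> 2 * C / real (J + 1)" by (simp add: g_def)
    also have "\<dots> \<le> 2 * C / (16 / \<epsilon>)"
      using J assms \<open>C \<ge> 0\<close> by (intro divide_left_mono mult_pos_pos) auto
    finally have g_le: "4 * real g \<le> \<epsilon> / 2 * C" using assms by (simp add: field_simps)
    have "20 / \<epsilon> * real n \<le> C"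
    proof -
      have "real c1 \<le> real n" "3 * c \<le> n" using c2(2) n(1) ck by linarith+
      then show ?thesis
        unfolding C_def using c1 c2(1) by (intro linear_le_binomial) auto
    qed
    then have n_le: "10 * real n \<le> \<epsilon> / 2 * C" using assms by (simp add: field_simps)
    define D where "D = weight n k c r"
    have D: "D > 0" "D \<le> real (k - r) + 2"
      unfolding D_def using weight_bounds[OF n(1-3) c2(1)] by simp_all
    have "k \<le> c * k" using c2 by simp
    then have "real k + 2 \<le> 2 * real n" using n(1,3) by linarith
    then have "D \<le> 2 * real n" using D(2) by (simp add: of_nat_diff)
    define y where "y = (C - 4 * real g - 8 * real n) / D"
    have "y - 1 \<le> real (SP n k)"
    proof (cases "y \<ge> 0")
      case False
      then show ?thesis by (simp add: order_trans[of _ 0])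
    next
      case True
      define p where "p = nat \<lfloor>y\<rfloor>"
      have p: "real p \<le> y" "y - 1 < real p" using True by (auto simp: p_def)
      then have "real p * D \<le> C - 4 * real g - 8 * real n"
        using D(1) by (simp add: y_def le_divide_eq)
      then have "p \<le> SP (2 * h) k"
        using n h c2(1) g unfolding D_def weight_def C_def by (intro SP_ge_even[of h c k r g p]) auto
      then show ?thesis using p(2) h by simp
    qed
    then have "(y - 1) * D \<le> real (SP n k) * D" using D(1) by (intro mult_right_mono) auto
    moreover have "y * D = C - 4 * real g - 8 * real n"
      using D(1) by (simp add: y_def)
    then have "(y - 1) * D = C - 4 * real g - 8 * real n - D"
      by (simp only: left_diff_distrib mult_1)
    ultimately have "C - \<epsilon> * C \<le> real (SP n k) * D"
      using g_le n_le \<open>D \<le> 2 * real n\<close> by linarith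
    then show ?thesis unfolding C_def D_def by (simp add: left_diff_distrib)
  qed
  moreover have "c0 \<ge> 2" by (simp add: c0_def)
  ultimately show ?thesis by blast
qed

lemma SP_mult_weight_ge_0:
  assumes "\<epsilon> > 0"
  shows "\<exists>c\<^sub>0\<ge>2. \<forall>k c. 3 \<le> k \<longrightarrow> c\<^sub>0 \<le> c \<longrightarrow>
    (1 - \<epsilon>) * real (c * k choose c) \<le> real (SP (c * k) k) * weight (c * k) k c 0"
proof -
  obtain c1 :: nat where c1: "2 / \<epsilon> + 1 < real c1" using reals_Archimedean2 by blast
  define c0 where "c0 = c1 + 2"
  have "(1 - \<epsilon>) * real (c * k choose c) \<le> real (SP (c * k) k) * weight (c * k) k c 0"
    if k: "3 \<le> k" "c0 \<le> c" for k c
  proof -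
    have ck: "c * 3 \<le> c * k" using k by simp
    have c2: "2 \<le> c" "c1 \<le> c" using k(2) by (auto simp: c0_def)
    define C where "C = real (c * k choose c)"
    have "real c1 \<le> real (c * k)" using c2(2) ck by linarith
    then have "1 / \<epsilon> * real (c * k) \<le> C"
      unfolding C_def using c1 ck c2 by (intro linear_le_binomial) auto
    then have "real (c * k) \<le> \<epsilon> * C" using assms by (simp add: field_simps)
    moreover have "k \<le> c * k" using c2 by simp
    ultimately have "real k \<le> \<epsilon> * C" by linarith
    moreover have "C \<le> real ((c * k choose c) div k) * real k + real k"
    proof -
      have "(c * k choose c) \<le> ((c * k choose c) div k) * k + k"
        using k by (metis add_le_cancel_left div_mult_mod_eq less_imp_le mod_less_divisor not_numeral_le_zero not_gr_zero)
      then have "real (c * k choose c) \<le> real (((c * k choose c) div k) * k + k)" by (simp only: of_nat_le_iff)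
      then show ?thesis by (simp add: C_def)
    qed
    moreover have "real ((c * k choose c) div k) * real k \<le> real (SP (c * k) k) * real k"
      using SP_ge_binomial_div[of c k] c2 k by (intro mult_right_mono) auto
    ultimately show ?thesis by (simp add: weight_def C_def left_diff_distrib)
  qed
  moreover have "c0 \<ge> 2" by (simp add: c0_def)
  ultimately show ?thesis by blast
qed

text \<open>The ratio of the two binomials is \<open>1 - c / (n + 1)\<close>, and
  \<open>c * k \<le> n\<close>.\<close>

lemma binomial_remove_point:
  assumes "c * k \<le> n" "c > 0" "k > 0"
  shows "(1 - 1 / real k) * real (Suc n choose c) \<le> real (n choose c)"
proof -
  have cn: "c \<le> n" using assms by (metis mult_le_mono2 nat_mult_1_right Suc_leI One_nat_def le_trans)
  have "(Suc n - c) * (Suc n choose c) = Suc n * (n choose c)"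
    using binomial_absorb_comp[of "Suc n" c] by simp
  then have eq: "(real (Suc n) - real c) * real (Suc n choose c) = real (Suc n) * real (n choose c)"
    using cn by (metis le_SucI of_nat_diff of_nat_mult)
  have "real c * real k \<le> real (Suc n)"
    using assms(1) by (metis le_SucI of_nat_le_iff of_nat_mult)
  then have "(1 - 1 / real k) * real (Suc n) \<le> real (Suc n) - real c"
    using assms(3) by (simp add: field_simps)
  then have "(1 - 1 / real k) * real (Suc n) * real (Suc n choose c) \<le> real (Suc n) * real (n choose c)"
    unfolding eq[symmetric] by (rule mult_right_mono) simp
  then have "real (Suc n) * ((1 - 1 / real k) * real (Suc n choose c)) \<le> real (Suc n) * real (n choose c)"
    by (simp only: mult_ac)
  then show ?thesis by (simp only: mult_le_cancel_left_pos of_nat_0_less_iff zero_less_Suc)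
qed

text \<open>With \<open>K = k - (r + s)\<close>, the weight goes from at most \<open>K + 4\<close>
  to at least \<open>K\<close>, which costs \<open>4 / K\<close>; the change of the binomial costs
  another \<open>2 / K\<close>.\<close>

lemma SP_mult_weight_add_points:
  assumes n: "n = c * k + r" "r + s < k" "3 \<le> k" "2 \<le> c" "s \<le> 2"
    and "0 \<le> \<epsilon>" "\<epsilon> \<le> 1"
    and ge: "(1 - \<epsilon>) * real (n choose c) \<le> real (SP n k) * weight n k c r"
  shows "(1 - \<epsilon> - 6 / real (k - (r + s))) * real (n + s choose c)
    \<le> real (SP (n + s) k) * weight (n + s) k c (r + s)"
proof -
  define K where "K = real (k - (r + s))"
  have K: "K \<ge> 1" "K \<le> real k" "real (k - r) \<le> K + 2" using n(2,5) by (auto simp: K_def)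
  have SP: "real (SP n k) \<le> real (SP (n + s) k)"
  proof -
    have "SP n k \<le> SP (n + t) k" for t
      by (induction t) (use SP_add_point[of k] n(3) in \<open>auto intro: le_trans\<close>)
    then show ?thesis by simp
  qed
  have w: "weight n k c r \<le> K + 4" "weight n k c r > 0"
    using weight_bounds[OF n(1) _ n(3,4)] n(2) K(3) by auto
  have w': "K \<le> weight (n + s) k c (r + s)"
    using weight_bounds(1)[of "n + s" c k "r + s"] n by (simp add: K_def)
  have bin: "(1 - 2 / K) * real (n + s choose c) \<le> real (n choose c)"
  proof -
    define t where "t = 1 - 1 / real k"
    have t: "0 \<le> t" "t \<le> 1" using n(3) by (auto simp: t_def)
    have step: "t * real (Suc m choose c) \<le> real (m choose c)" if "n \<le> m" for m
      unfolding t_def by (rule binomial_remove_point) (use that n in auto)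
    have "t ^ u * real (n + u choose c) \<le> real (n choose c)" for u
    proof (induction u)
      case (Suc u)
      have "t ^ Suc u * real (n + Suc u choose c) = t ^ u * (t * real (Suc (n + u) choose c))"
        by simp
      also have "\<dots> \<le> t ^ u * real (n + u choose c)"
        using t(1) step[of "n + u"] by (intro mult_left_mono) auto
      finally show ?case using Suc by linarith
    qed simp
    then have "t ^ s * real (n + s choose c) \<le> real (n choose c)" .
    moreover have "t ^ 2 \<le> t ^ s" using n(5) t by (rule power_decreasing)
    moreover have "1 - 2 / K \<le> t ^ 2"
    proof -
      have "1 / real k \<le> 1 / K" using K by (intro divide_left_mono) auto
      then have "1 - 2 / K \<le> 1 - 2 / real k" by (simp add: field_simps)
      also have "\<dots> \<le> t ^ 2" by (simp add: t_def power2_eq_square algebra_simps)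
      finally show ?thesis .
    qed
    ultimately show ?thesis
      by (meson mult_right_mono of_nat_0_le_iff order_trans)
  qed
  show ?thesis
  proof (cases "\<epsilon> + 6 / K \<le> 1")
    case False
    then have "1 - \<epsilon> - 6 / K \<le> 0" by simp
    then have "(1 - \<epsilon> - 6 / K) * real (n + s choose c) \<le> 0" by (simp add: mult_nonpos_nonneg)
    also have "\<dots> \<le> real (SP (n + s) k) * weight (n + s) k c (r + s)" using w' K by simp
    finally show ?thesis by (simp only: K_def)
  next
    case True
    define a where "a = 1 / K"
    have a: "0 < a" "6 * a \<le> 1 - \<epsilon>" using True K by (auto simp: a_def)
    define N where "N = real (n + s choose c)"
    have "N \<ge> 0" by (simp add: N_def)
    have "(1 - \<epsilon> - 6 * a) \<le> (1 - 4 * a) * ((1 - \<epsilon>) * (1 - 2 * a))"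
    proof -
      have "0 \<le> \<epsilon> * (6 * a) + 8 * a * a * (1 - \<epsilon>)"
        using a assms(6,7) by (intro add_nonneg_nonneg mult_nonneg_nonneg) auto
      then show ?thesis by (simp add: algebra_simps)
    qed
    then have "(1 - \<epsilon> - 6 * a) * N \<le> (1 - 4 * a) * ((1 - \<epsilon>) * (1 - 2 * a)) * N"
      using \<open>N \<ge> 0\<close> by (rule mult_right_mono)
    also have "\<dots> = (1 - 4 * a) * ((1 - \<epsilon>) * ((1 - 2 / K) * N))" by (simp add: a_def)
    also have "\<dots> \<le> (1 - 4 * a) * ((1 - \<epsilon>) * real (n choose c))"
      using bin a assms(6,7) unfolding N_def by (intro mult_left_mono) auto
    also have "\<dots> \<le> (1 - 4 * a) * (real (SP n k) * (K + 4))"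
    proof (rule mult_left_mono)
      have "real (SP n k) * weight n k c r \<le> real (SP n k) * (K + 4)"
        using w by (intro mult_left_mono) auto
      then show "(1 - \<epsilon>) * real (n choose c) \<le> real (SP n k) * (K + 4)"
        using ge by linarith
    qed (use a assms(6) in auto)
    also have "\<dots> = real (SP n k) * ((1 - 4 * a) * (K + 4))" by simp
    also have "\<dots> \<le> real (SP n k) * K"
    proof (rule mult_left_mono)
      have "(1 - 4 * a) * (K + 4) = K - 16 * a" using K by (simp add: a_def field_simps)
      then show "(1 - 4 * a) * (K + 4) \<le> K" using a by simp
    qed simp
    also have "\<dots> \<le> real (SP (n + s) k) * weight (n + s) k c (r + s)"
      using SP w' K by (intro mult_mono) auto
    finally show ?thesis by (simp add: a_def K_def N_def)
  qed
qed

lemma SP_div_MMS_bounds: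
  assumes n: "n = c * k + r" "r < k" "3 \<le> k" "2 \<le> c"
    and "x * real (n choose c) \<le> real (SP n k) * weight n k c r"
  shows "x \<le> real (SP n k) / MMS n k" "real (SP n k) / MMS n k \<le> 1"
proof -
  have "c \<le> n" using n(1,3) by (cases k) auto
  then have C: "real (n choose c) > 0" by simp
  have eq: "real (SP n k) / MMS n k = real (SP n k) * weight n k c r / real (n choose c)"
    using weight_bounds(3)[OF n(1-4)] by (simp add: MMS_eq[OF n(1,2)])
  show "x \<le> real (SP n k) / MMS n k"
    unfolding eq using assms(5) C by (simp add: le_divide_eq)
  show "real (SP n k) / MMS n k \<le> 1"
    unfolding eq using SP_mult_weight_le[OF n(1-4)] C by (simp add: divide_le_eq)
qed

lemma SP_div_MMS_ge:
  assumes "0 < \<epsilon>" "\<epsilon> \<le> 1"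
  shows "\<exists>c\<^sub>0\<ge>2. \<forall>n k c r. n = c * k + r \<longrightarrow> r < k \<longrightarrow> 3 \<le> k \<longrightarrow> c\<^sub>0 \<le> c \<longrightarrow>
    even n \<and> r \<notin> {1, k - 1} \<or> 6 / real (k - r) \<le> \<epsilon> \<longrightarrow> 1 - 2 * \<epsilon> \<le> real (SP n k) / MMS n k"
proof -
  obtain c1 where c1: "2 \<le> c1" "\<And>n k c r. n = c * k + r \<Longrightarrow> r < k \<Longrightarrow> 3 \<le> k \<Longrightarrow> c1 \<le> c \<Longrightarrow> even n \<Longrightarrow> r \<noteq> 1 \<Longrightarrow>
      r \<noteq> k - 1 \<Longrightarrow> (1 - \<epsilon>) * real (n choose c) \<le> real (SP n k) * weight n k c r"
    using SP_mult_weight_ge_even[OF assms(1)] by auto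
  obtain c2 where c2: "\<And>k c. 3 \<le> k \<Longrightarrow> c2 \<le> c \<Longrightarrow>
      (1 - \<epsilon>) * real (c * k choose c) \<le> real (SP (c * k) k) * weight (c * k) k c 0"
    using SP_mult_weight_ge_0[OF assms(1)] by auto
  have "1 - 2 * \<epsilon> \<le> real (SP n k) / MMS n k"
    if n: "n = c * k + r" "r < k" "3 \<le> k" "c1 + c2 \<le> c"
      and alt: "even n \<and> r \<notin> {1, k - 1} \<or> 6 / real (k - r) \<le> \<epsilon>" for n k c r
  proof (rule SP_div_MMS_bounds(1)[OF n(1-3)])
    show c: "2 \<le> c" using n(4) c1(1) by linarith
    define good where "good m q \<longleftrightarrow> (1 - \<epsilon>) * real (m choose c) \<le> real (SP m k) * weight m k c q" for m q
    have good_even: "good (c * k + q) q" if "q < k" "even (c * k + q)" "q \<noteq> 1" "q \<noteq> k - 1" for q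
      unfolding good_def using c1(2)[OF refl] that n(3,4) by simp
    have good_0: "good (c * k + 0) 0"
      unfolding good_def using c2[of k c] n(3,4) by simp
    have C: "0 \<le> real (n choose c)" by simp
    show "(1 - 2 * \<epsilon>) * real (n choose c) \<le> real (SP n k) * weight n k c r"
      using alt
    proof
      assume "even n \<and> r \<notin> {1, k - 1}"
      then have "(1 - \<epsilon>) * real (n choose c) \<le> real (SP n k) * weight n k c r"
        using good_even[of r] n(1,2) by (simp add: good_def)
      moreover have "(1 - 2 * \<epsilon>) * real (n choose c) \<le> (1 - \<epsilon>) * real (n choose c)"
        using assms(1) by (intro mult_right_mono) auto
      ultimately show ?thesis by linarith
    next
      assume 6: "6 / real (k - r) \<le> \<epsilon>"
      then have "6 / real (k - r) \<le> 1"
        using assms(2) by (rule order_trans)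
      moreover have "0 < real (k - r)"
        using n(2) by simp
      ultimately have "6 \<le> real (k - r)"
        by (simp only: divide_le_eq_1_pos)
      then have kr: "r + 6 \<le> k" using n(2) by linarith
      obtain s q where s: "r = q + s" "s \<le> 2" "good (c * k + q) q"
      proof -
        \<comment> \<open>The gap \<open>k - r\<close> keeps the remainder away from
          \<open>k - 1\<close>, and \<open>r \<ge> 3\<close> keeps \<open>r - 1\<close> away from
          \<open>1\<close>. Remainders up to \<open>2\<close> are lowered to \<open>0\<close>, which
          bounds \<open>s\<close> by \<open>2\<close>.\<close>
        consider "r \<le> 2" | "r \<ge> 3" "even n" | "r \<ge> 3" "odd n" by linarith
        then show thesis
        proof cases
          case 1
          then show ?thesis using good_0 by (intro that[of 0 r]) auto
        next
          case 2
          then show ?thesis using good_even[of r] n(1,2) kr by (intro that[of r 0]) auto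
        next
          case 3
          then have "even (c * k + (r - 1))" using n(1) by auto
          then show ?thesis using good_even[of "r - 1"] 3 n(2) kr by (intro that[of "r - 1" 1]) auto
        qed
      qed
      have "(1 - \<epsilon> - 6 / real (k - (q + s))) * real (c * k + q + s choose c)
          \<le> real (SP (c * k + q + s) k) * weight (c * k + q + s) k c (q + s)"
        using s n(2,3) c assms by (intro SP_mult_weight_add_points) (auto simp: good_def)
      then have "(1 - \<epsilon> - 6 / real (k - r)) * real (n choose c) \<le> real (SP n k) * weight n k c r"
        using s(1) n(1) by (simp add: add.assoc)
      moreover have "(1 - 2 * \<epsilon>) * real (n choose c) \<le> (1 - \<epsilon> - 6 / real (k - r)) * real (n choose c)"
        using 6 by (intro mult_right_mono) auto
      ultimately show ?thesis by linarith
    qed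
  qed
  moreover have "2 \<le> c1 + c2" using c1(1) by simp
  ultimately show ?thesis by blast
qed

theorem theorem1:
  fixes n k c r :: "nat \<Rightarrow> nat"
  assumes "\<And>j. j \<ge> 1 \<Longrightarrow> n j \<ge> k j \<and> k j \<ge> 3"
    and "filterlim n at_top sequentially"
    and "(\<lambda>j. real (k j) / real (n j)) \<longlonglongrightarrow> 0"
    and "\<And>j. j \<ge> 1 \<Longrightarrow> n j = c j * k j + r j \<and> r j \<in> {0..k j - 1}"
    and "(\<forall>j\<ge>1. even (n j) \<and> r j \<notin> {1, k j - 1}) \<or>
         filterlim (\<lambda>j. k j - r j) at_top sequentially"
  shows "(\<lambda>j. real (SP (n j) (k j)) / MMS (n j) (k j)) \<longlonglongrightarrow> 1"
proof -
  have basic: "n j = c j * k j + r j" "r j < k j" "3 \<le> k j" if "j \<ge> 1" for j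
    using assms(1,4)[OF that] by auto
  have large: "eventually (\<lambda>j. C \<le> c j) sequentially" for C
  proof -
    have "eventually (\<lambda>j. real (k j) / real (n j) < 1 / (real C + 1)) sequentially"
      using assms(3) by (rule order_tendstoD) simp
    then show ?thesis
      using eventually_ge_at_top[of 1]
    proof eventually_elim
      case (elim j)
      have "n j > 0" using assms(1)[OF elim(2)] by simp
      then have "real (k j) * (real C + 1) < real (n j)" using elim(1) by (simp add: field_simps)
      then have "real (k j * (C + 1)) < real (n j)" by (simp add: algebra_simps)
      then have "k j * (C + 1) < n j" by (simp only: of_nat_less_iff)
      also have "n j < k j * (c j + 1)" using basic[OF elim(2)] by (simp add: algebra_simps)
      finally show ?case by simp
    qed
  qed
  show ?thesis
  proof (rule order_tendstoI)
    fix a :: real assume "a < 1"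
    define \<epsilon> where "\<epsilon> = min 1 ((1 - a) / 3)"
    have \<epsilon>: "0 < \<epsilon>" "\<epsilon> \<le> 1" "a < 1 - 2 * \<epsilon>" using \<open>a < 1\<close> by (auto simp: \<epsilon>_def min_def field_simps)
    obtain C where C: "\<And>n k c r. n = c * k + r \<Longrightarrow> r < k \<Longrightarrow> 3 \<le> k \<Longrightarrow> C \<le> c \<Longrightarrow>
      even n \<and> r \<notin> {1, k - 1} \<or> 6 / real (k - r) \<le> \<epsilon> \<Longrightarrow> 1 - 2 * \<epsilon> \<le> real (SP n k) / MMS n k"
      using SP_div_MMS_ge[OF \<epsilon>(1,2)] by blast
    have alt: "eventually (\<lambda>j. even (n j) \<and> r j \<notin> {1, k j - 1} \<or> 6 / real (k j - r j) \<le> \<epsilon>) sequentially"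
      using assms(5)
    proof
      assume "\<forall>j\<ge>1. even (n j) \<and> r j \<notin> {1, k j - 1}"
      then show ?thesis
        by (intro eventually_sequentiallyI[of 1]) blast
    next
      assume "filterlim (\<lambda>j. k j - r j) at_top sequentially"
      then have "eventually (\<lambda>j. nat \<lceil>6 / \<epsilon>\<rceil> + 1 \<le> k j - r j) sequentially"
        by (simp add: filterlim_at_top)
      then show ?thesis
      proof eventually_elim
        case (elim j)
        have "6 / \<epsilon> \<le> real (nat \<lceil>6 / \<epsilon>\<rceil>)" by (rule real_nat_ceiling_ge)
        then have "6 / \<epsilon> \<le> real (k j - r j)" "0 < real (k j - r j)" using elim by linarith+
        then show ?case using \<epsilon>(1) by (simp add: field_simps)
      qed
    qed
    show "eventually (\<lambda>j. a < real (SP (n j) (k j)) / MMS (n j) (k j)) sequentially"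
      using alt large[of C] eventually_ge_at_top[of 1]
    proof eventually_elim
      case (elim j)
      show ?case using C[OF basic[OF elim(3)] elim(2,1)] \<epsilon>(3) by simp
    qed
  next
    fix a :: real assume "1 < a"
    show "eventually (\<lambda>j. real (SP (n j) (k j)) / MMS (n j) (k j) < a) sequentially"
      using large[of 2] eventually_ge_at_top[of 1]
    proof eventually_elim
      case (elim j)
      have "real (SP (n j) (k j)) / MMS (n j) (k j) \<le> 1"
        using SP_div_MMS_bounds(2)[OF basic[OF elim(2)] elim(1), of 0] weight_bounds(3)[OF basic[OF elim(2)] elim(1)]
        by simp
      then show ?case using \<open>1 < a\<close> by simp
    qed
  qed
qed

end
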